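(* Let $\mathsf{C}$ be a two-agent NS-CSG ($N=\{1,2\}$) with rewards $r$, horizon $K$ and initial state $s\in S$, and let $C^{\mathrm N}(\mu^{\mathrm N},V)$ and $C^{\mathrm C}(\mu^{\mathrm C},V)$ be the constraint systems defined in the context. Then: (i) a strategy profile $\sigma=(\sigma_1,\sigma_2)$ is an SPNE for $s$ if and only if there is a solution $(\mu^{\mathrm N},V)$ of the constraints $C^{\mathrm N}(\mu^{\mathrm N},V)$ such that $\sigma_1(h)=\mu_1^h$ and $\sigma_2(h)=\mu_2^h$ for each $h\in H_s^{<K}$; (ii) a correlated profile $\tau$ is an SPCE for $s$ if and only if there is a solution $(\mu^{\mathrm C},V)$ of the constraints $C^{\mathrm C}(\mu^{\mathrm C},V)$ such that $\tau(h)=\mu^h$ for each $h\in H_s^{<K}$; (iii) a strategy profile $\sigma$ is an SW-SPNE for $s$ if and only if there is an optimal solution $(\mu^*,V^* )$ of the nonlinear program $$\max_{\mu^{\mathrm N},V}\ \sum_{i\in N}V_i^s\quad\text{subject to } C^{\mathrm N}(\mu^{\mathrm N},V)$$ such that $\sigma_1(h)=\mu_1^{*,h}$ and $\sigma_2(h)=\mu_2^{*,h}$ for each $h\in H_s^{<K}$, and the social welfare $W_{0,s}^{\sigma}$ is equal to the optimal value $\sum_{i\in N}V_i^{*,s}$; (iv) a correlated profile $\tau$ is an SW-SPCE for $s$ if and only if there is an optimal solution $(\mu^*,V^* )$ of the nonlinear program $$\max_{\mu^{\mathrm C},V}\ \sum_{i\in N}V_i^s\quad\text{subject to } C^{\mathrm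 C}(\mu^{\mathrm C},V)$$ such that $\tau(h)=\mu^{*,h}$ for each $h\in H_s^{<K}$, and the social welfare $W_{0,s}^{\tau}$ is equal to the optimal value $\sum_{i\in N}V_i^{*,s}$.
   Context: **NS-CSG.** A neuro-symbolic concurrent stochastic game (NS-CSG) $\mathsf{C}$ consists of agents $\mathsf{Ag}_i=(S_i,A_i,\Delta_i,\mathit{obs}_i,\delta_i)$, $i\in N=\{1,\dots,n\}$, and an environment $E=(S_E,\delta_E)$, where: $S_i=\mathit{Loc}_i\times \mathit{Per}_i$ with $\mathit{Loc}_i\subseteq\mathbb{R}^{b_i}$, $\mathit{Per}_i\subseteq\mathbb{R}^{d_i}$ finite (local states and percepts); $S_E\subseteq\mathbb{R}^e$ is a finite or infinite set; $A_i$ is a nonempty finite action set, and $A=(A_1\cup\{\bot\})\times\cdots\times(A_n\cup\{\bot\})$ is the set of joint actions with $\bot\notin\bigcup_i A_i$ an idle action; $\Delta_i:S_i\to 2^{A_i}$ gives available actions; $\mathit{obs}_i:S_1\times\cdots\times S_n\times S_E\to \mathit{Per}_i$ is an observation function (implemented by a neural network classifier; for the present purposes just a function); $\delta_i:S_i\times A\to\mathbb{P}(\mathit{Loc}_i)$ is a probabilistic transition function, where $\mathbb{P}(X)$ is the set of probability distributions on $X$; $\delta_E:S_E\times A\to S_E$ is a deterministic environment transition function. The set of global states is $S=S_1\times\cdots\times S_n\times S_E$. For $s=(s_1,\dots,s_n,s_E)\in S$ with $s_i=(\mathit{loc}_i,\mathit{per}_i)$, let $A_i(s)=\Delta_i(s_i)$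 if this is nonempty and $A_i(s)=\{\bot\}$ otherwise, and $A(s)=A_1(s)\times\cdots\times A_n(s)$. For $\alpha\in A(s)$, writing $\mathit{per}_i'=\mathit{obs}_i(s)$, the next state is $s'=((\mathit{loc}_1',\mathit{per}_1'),\dots,(\mathit{loc}_n',\mathit{per}_n'),\delta_E(s_E,\alpha))$ with probability $\delta(s,\alpha)(s')=\prod_{i}\delta_i((\mathit{loc}_i,\mathit{per}_i'),\alpha)(\mathit{loc}_i')$, and $\delta(s,\alpha)$ is zero on all states not of this form. **Histories.** Fix a horizon $K\ge 1$. A history in stage $\ell\in\{0,\dots,K\}$ is a sequence $h=s^0\xrightarrow{\alpha^0}s^1\cdots\xrightarrow{\alpha^{\ell-1}}s^\ell$ with $\alpha^k\in A(s^k)$ and $\delta(s^k,\alpha^k)(s^{k+1})>0$; $last(h)=s^\ell$. $H^\ell$ (resp. $H^\ell_s$) is the set of histories in stage $\ell$ (resp. with $s^0=s$), $H^{<K}=\bigcup_{\ell<K}H^\ell$, $H_s^{<K}=\bigcup_{\ell<K}H_s^\ell$, $H_s=H_s^{<K}\cup H_s^K$. $\mathrm{Succ}(h)$ is the set of one-stage successors of $h\in H^{<K}$. A path from $h\in H^\ell$ is a sequence $\pi=s^\ell\xrightarrow{\alpha^\ell}\cdots\xrightarrow{\alpha^{K-1}}s^K$ of positive-probability transitions with $s^\ell=last(h)$. **Profiles.** A strategy of agent $i$ is $\sigma_i:H^{<K}\to\mathbb{P}(A_i\cup\{\bot\})$ with $\sigma_i(h)$ supported on $A_i(last(h))$; $\Sigma_i^{\mathrm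 N}$ is the set of these; a strategy profile is $\sigma=(\sigma_1,\dots,\sigma_n)$ (agents randomise independently). $\sigma_{-i}[\sigma_i']$ is $\sigma$ with $\sigma_i$ replaced by $\sigma_i'$. A correlated profile is $\tau:H^{<K}\to\mathbb{P}(A)$ with $\tau(h)$ supported on $A(last(h))$. **Rewards.** Each agent has reward functions $r_i^A:S\times A\to\mathbb{R}$, $r_i^S:S\to\mathbb{R}$. For a path $\pi$ from stage $\ell$, $Y_i(\pi)=\sum_{k=\ell}^{K-1}\big(r_i^A(s^k,\alpha^k)+r_i^S(s^k)\big)+r_i^S(s^K)$. $\mathbb{E}^{\sigma}_{\ell,h}[Y_i]$ (resp. $\mathbb{E}^\tau_{\ell,h}[Y_i]$) is the expectation of $Y_i$ over paths from $h\in H^\ell$ under $\sigma$ (resp. $\tau$). $\mathbb{E}^\tau_\ell[Y_i,a_i'\mid a_i,h]$ is the expectation of $Y_i$ from $h\in H^\ell$ conditional on $\tau(h)$ having recommended $a_i$ to agent $i$, when agent $i$ plays $a_i'$ at $h$ and otherwise all agents follow the recommendations of $\tau$ (at $h$ and afterwards). **Equilibria.** For an initial state $s$: $\sigma^*$ is a subgame-perfect Nash equilibrium (SPNE) if $\mathbb{E}^{\sigma^*}_{\ell,h}[Y_i]\ge\mathbb{E}^{\sigma^*_{-i}[\sigma_i]}_{\ell,h}[Y_i]$ for all $\sigma_i\in\Sigma_i^{\mathrm N}$, $i\in N$, $\ell<K$ and $h\in H_s^\ell$. $\tau^*$ is a subgame-perfect correlated equilibrium (SPCE) if $\mathbb{E}^{\tau^*}_\ell[Y_i,a_i\mid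 a_i,h]\ge\mathbb{E}^{\tau^*}_\ell[Y_i,a_i'\mid a_i,h]$ for all $i\in N$, $\ell<K$, $h\in H_s^\ell$ and $a_i,a_i'\in A_i(last(h))$ (the condition being vacuous when $a_i$ is recommended with probability $0$ at $h$). **Social welfare.** $W^{\sigma}_{\ell,h}=\mathbb{E}^\sigma_{\ell,h}[\sum_i Y_i]$ and $W^{\tau}_{\ell,h}=\mathbb{E}^\tau_{\ell,h}[\sum_i Y_i]$; $W_{0,s}$ refers to the length-zero history $s$. An SPNE $\sigma^*$ for $s$ is an SW-SPNE if $W_{0,s}^{\sigma^*}\ge W_{0,s}^{\sigma}$ for all SPNEs $\sigma$ for $s$; an SPCE $\tau^*$ is an SW-SPCE if $W_{0,s}^{\tau^*}\ge W_{0,s}^{\tau}$ for all SPCEs $\tau$ for $s$. **Constraint systems (two agents).** For $h\in H_s^K$ put $V^h=(r_1^S(last(h)),r_2^S(last(h)))$ (constants). For $h\in H_s^{<K}$ there are real variables $V^h=(V_1^h,V_2^h)$; for $C^{\mathrm N}$ also variables $\mu_i^h=(\mu_i^h(a_i))_{a_i\in A_i(last(h))}$, $i=1,2$; for $C^{\mathrm C}$ also variables $\mu^h=(\mu^h_\alpha)_{\alpha\in A(last(h))}$. For $h\in H_s^{<K}$ and $\alpha\in A(last(h))$ let $$\mathsf{Z}_i^{h,\alpha}=r_i^A(last(h),\alpha)+r_i^S(last(h))+\sum_{h'}\delta(last(h),\alpha)(last(h'))\,V_i^{h'},\qquad(\ast)$$ the sum being over the successors $h'=h\xrightarrow{\alpha}s'$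 of $h$ via $\alpha$. Below, $A_i$ abbreviates $A_i(last(h))$, $A$ abbreviates $A(last(h))$, and $(a_i,a_j)$ is the joint action in which agent $i$ plays $a_i$ and agent $j$ plays $a_j$. $C^{\mathrm N}(\mu^{\mathrm N},V)$, with $\mu^{\mathrm N}=\{\mu_1^h,\mu_2^h\}_{h\in H_s^{<K}}$ and $V=\{V^h\}_{h\in H_s^{<K}}$, consists, for all $h\in H_s^{<K}$ and $i,j\in\{1,2\}$, $i\neq j$, of $(\ast)$ and - $V_i^h-\sum_{(a_i,a_j)\in A_i\times A_j}\mu_i^h(a_i)\mu_j^h(a_j)\mathsf{Z}_i^{h,(a_i,a_j)}=0$; - $V_i^h-\sum_{a_j\in A_j}\mu_j^h(a_j)\mathsf{Z}_i^{h,(a_i,a_j)}\ge 0$ for all $a_i\in A_i$; - $\sum_{a_i\in A_i}\mu_i^h(a_i)=1$ and $\mu_i^h(a_i)\ge0$ for all $a_i\in A_i$. $C^{\mathrm C}(\mu^{\mathrm C},V)$, with $\mu^{\mathrm C}=\{\mu^h\}_{h\in H_s^{<K}}$, consists, for all $h\in H_s^{<K}$ and $i,j\in\{1,2\}$, $i\ne j$, of $(\ast)$ and - $V_i^h-\sum_{\alpha\in A}\mu^h_\alpha\mathsf{Z}_i^{h,\alpha}=0$; - $\sum_{a_j\in A_j}\big(\mathsf{Z}_i^{h,(a_i,a_j)}-\mathsf{Z}_i^{h,(a_i',a_j)}\big)\mu^h_{(a_i,a_j)}\ge0$ for all $a_i,a_i'\in A_i$; - $\sum_{\alpha\in A}\mu_\alpha^h=1$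 and $\mu_\alpha^h\ge0$ for all $\alpha\in A$. *)

theory Defs
  imports "HOL-Probability.Product_PMF"
begin

text \<open>
  Agents are the elements of a finite type \<open>'i\<close>; a two-agent game is one with \<open>CARD('i) = 2\<close>.
  A vector of \<open>\<real>\<^sup>b\<close> is a real list of length \<open>b\<close>, so that the dimension may depend on the agent.
  The idle action is \<open>None\<close>; an action \<open>a\<close> of an agent occurs in joint actions as \<open>Some a\<close>.
  Probability distributions on \<open>X\<close> are the \<open>pmf\<close>s whose support is contained in \<open>X\<close>.
\<close>

type_synonym lstate = "real list \<times> real list"
type_synonym 'i gstate = "('i \<Rightarrow> lstate) \<times> real list"
type_synonym ('i, 'a) jact = "'i \<Rightarrow> 'a option"

record ('i, 'a) ns_csg =
  loc_dim :: "'i \<Rightarrow> nat"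
  per_dim :: "'i \<Rightarrow> nat"
  env_dim :: nat
  Loc :: "'i \<Rightarrow> real list set"
  Per :: "'i \<Rightarrow> real list set"
  Env :: "real list set"
  Act :: "'i \<Rightarrow> 'a set"
  avail :: "'i \<Rightarrow> lstate \<Rightarrow> 'a set"
  obs :: "'i \<Rightarrow> 'i gstate \<Rightarrow> real list"
  ltrans :: "'i \<Rightarrow> lstate \<Rightarrow> ('i, 'a) jact \<Rightarrow> real list pmf"
  etrans :: "real list \<Rightarrow> ('i, 'a) jact \<Rightarrow> real list"

definition lstates :: "('i, 'a) ns_csg \<Rightarrow> 'i \<Rightarrow> lstate set" where
  "lstates C i = Loc C i \<times> Per C i"

definition gstates :: "('i, 'a) ns_csg \<Rightarrow> 'i gstate set" where
  "gstates C = {s. (\<forall>i. fst s i \<in> lstates C i) \<and> snd s \<in> Env C}"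

definition jacts :: "('i, 'a) ns_csg \<Rightarrow> ('i, 'a) jact set" where
  "jacts C = {\<alpha>. \<forall>i. \<alpha> i \<in> insert None (Some ` Act C i)}"

definition is_ns_csg :: "('i::finite, 'a) ns_csg \<Rightarrow> bool" where
  "is_ns_csg C \<longleftrightarrow>
     (\<forall>i. finite (Loc C i) \<and> (\<forall>v \<in> Loc C i. length v = loc_dim C i)) \<and>
     (\<forall>i. finite (Per C i) \<and> (\<forall>v \<in> Per C i. length v = per_dim C i)) \<and>
     (\<forall>v \<in> Env C. length v = env_dim C) \<and>
     (\<forall>i. finite (Act C i) \<and> Act C i \<noteq> {}) \<and>
     (\<forall>i. \<forall>x \<in> lstates C i. avail C i x \<subseteq> Act C i) \<and>
     (\<forall>i. \<forall>s \<in> gstates C. obs C i s \<in> Per C i) \<and>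
     (\<forall>i. \<forall>x \<in> lstates C i. \<forall>\<alpha> \<in> jacts C. set_pmf (ltrans C i x \<alpha>) \<subseteq> Loc C i) \<and>
     (\<forall>e \<in> Env C. \<forall>\<alpha> \<in> jacts C. etrans C e \<alpha> \<in> Env C)"

definition acts_at :: "('i, 'a) ns_csg \<Rightarrow> 'i \<Rightarrow> 'i gstate \<Rightarrow> 'a option set" where
  "acts_at C i s = (if avail C i (fst s i) = {} then {None} else Some ` avail C i (fst s i))"

definition jacts_at :: "('i, 'a) ns_csg \<Rightarrow> 'i gstate \<Rightarrow> ('i, 'a) jact set" where
  "jacts_at C s = {\<alpha>. \<forall>i. \<alpha> i \<in> acts_at C i s}"

definition trans_prob ::
    "('i::finite, 'a) ns_csg \<Rightarrow> 'i gstate \<Rightarrow> ('i, 'a) jact \<Rightarrow> 'i gstate \<Rightarrow> real" where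
  "trans_prob C s \<alpha> s' =
     (if (\<forall>i. snd (fst s' i) = obs C i s) \<and> snd s' = etrans C (snd s) \<alpha>
      then \<Prod>i\<in>UNIV. pmf (ltrans C i (fst (fst s i), obs C i s) \<alpha>) (fst (fst s' i))
      else 0)"

text \<open>
  A run \<open>(s\<^sub>0, [(\<alpha>\<^sub>0, s\<^sub>1), (\<alpha>\<^sub>1, s\<^sub>2), \<dots>])\<close> stands for the sequence
  \<open>s\<^sub>0 \<rightarrow> s\<^sub>1 \<rightarrow> s\<^sub>2 \<rightarrow> \<dots>\<close> in which the \<open>k\<close>-th transition is by \<open>\<alpha>\<^sub>k\<close>. It serves both for
  histories and for paths, a path starting in the last state of a history.
\<close>

type_synonym ('i, 'a) run = "'i gstate \<times> (('i, 'a) jact \<times> 'i gstate) list"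

definition stage :: "('i, 'a) run \<Rightarrow> nat" where
  "stage h = length (snd h)"

definition state_at :: "('i, 'a) run \<Rightarrow> nat \<Rightarrow> 'i gstate" where
  "state_at h k = (fst h # map snd (snd h)) ! k"

definition act_at :: "('i, 'a) run \<Rightarrow> nat \<Rightarrow> ('i, 'a) jact" where
  "act_at h k = fst (snd h ! k)"

definition last_state :: "('i, 'a) run \<Rightarrow> 'i gstate" where
  "last_state h = state_at h (stage h)"

definition init_hist :: "'i gstate \<Rightarrow> ('i, 'a) run" where
  "init_hist s = (s, [])"

definition ext_hist :: "('i, 'a) run \<Rightarrow> ('i, 'a) jact \<Rightarrow> 'i gstate \<Rightarrow> ('i, 'a) run" where
  "ext_hist h \<alpha> s' = (fst h, snd h @ [(\<alpha>, s')])"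

definition is_run :: "('i::finite, 'a) ns_csg \<Rightarrow> ('i, 'a) run \<Rightarrow> bool" where
  "is_run C h \<longleftrightarrow>
     (\<forall>k \<le> stage h. state_at h k \<in> gstates C) \<and>
     (\<forall>k < stage h. act_at h k \<in> jacts_at C (state_at h k) \<and>
        trans_prob C (state_at h k) (act_at h k) (state_at h (Suc k)) > 0)"

definition hists :: "('i::finite, 'a) ns_csg \<Rightarrow> nat \<Rightarrow> ('i, 'a) run set" where
  "hists C l = {h. is_run C h \<and> stage h = l}"

definition hists_from :: "('i::finite, 'a) ns_csg \<Rightarrow> 'i gstate \<Rightarrow> nat \<Rightarrow> ('i, 'a) run set" where
  "hists_from C s l = {h \<in> hists C l. fst h = s}"

definition dec_hists :: "('i::finite, 'a) ns_csg \<Rightarrow> nat \<Rightarrow> ('i, 'a) run set" where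
  "dec_hists C K = (\<Union>l<K. hists C l)"

definition dec_hists_from ::
    "('i::finite, 'a) ns_csg \<Rightarrow> nat \<Rightarrow> 'i gstate \<Rightarrow> ('i, 'a) run set" where
  "dec_hists_from C K s = (\<Union>l<K. hists_from C s l)"

definition paths :: "('i::finite, 'a) ns_csg \<Rightarrow> nat \<Rightarrow> ('i, 'a) run \<Rightarrow> ('i, 'a) run set" where
  "paths C K h = {\<pi>. is_run C \<pi> \<and> fst \<pi> = last_state h \<and> stage h + stage \<pi> = K}"

text \<open>Strategies and profiles are total functions; their values outside \<open>dec_hists C K\<close> are
  unconstrained and never used.\<close>

type_synonym ('i, 'a) strategy = "('i, 'a) run \<Rightarrow> 'a option pmf"
type_synonym ('i, 'a) corr_profile = "('i, 'a) run \<Rightarrow> ('i, 'a) jact pmf"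

definition strategies :: "('i::finite, 'a) ns_csg \<Rightarrow> nat \<Rightarrow> 'i \<Rightarrow> ('i, 'a) strategy set" where
  "strategies C K i = {f. \<forall>h \<in> dec_hists C K. set_pmf (f h) \<subseteq> acts_at C i (last_state h)}"

definition strategy_profiles ::
    "('i::finite, 'a) ns_csg \<Rightarrow> nat \<Rightarrow> ('i \<Rightarrow> ('i, 'a) strategy) set" where
  "strategy_profiles C K = {\<sigma>. \<forall>i. \<sigma> i \<in> strategies C K i}"

definition corr_profiles :: "('i::finite, 'a) ns_csg \<Rightarrow> nat \<Rightarrow> ('i, 'a) corr_profile set" where
  "corr_profiles C K =
     {\<tau>. \<forall>h \<in> dec_hists C K. set_pmf (\<tau> h) \<subseteq> jacts_at C (last_state h)}"

definition indep_profile :: "('i::finite \<Rightarrow> ('i, 'a) strategy) \<Rightarrow> ('i, 'a) corr_profile" where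
  "indep_profile \<sigma> h = Pi_pmf UNIV None (\<lambda>i. \<sigma> i h)"

record ('i, 'a) rewards =
  act_rew :: "'i \<Rightarrow> 'i gstate \<Rightarrow> ('i, 'a) jact \<Rightarrow> real"
  state_rew :: "'i \<Rightarrow> 'i gstate \<Rightarrow> real"

definition payoff :: "('i, 'a) rewards \<Rightarrow> 'i \<Rightarrow> ('i, 'a) run \<Rightarrow> real" where
  "payoff r i \<pi> =
     (\<Sum>k<stage \<pi>. act_rew r i (state_at \<pi> k) (act_at \<pi> k) + state_rew r i (state_at \<pi> k))
       + state_rew r i (last_state \<pi>)"

text \<open>The \<open>k\<close>-th decision on a path \<open>\<pi>\<close> from \<open>h\<close> is taken at the history that extends \<open>h\<close> by
  the first \<open>k\<close> transitions of \<open>\<pi>\<close>.\<close>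

definition path_prob ::
    "('i::finite, 'a) ns_csg \<Rightarrow> ('i, 'a) corr_profile \<Rightarrow> ('i, 'a) run \<Rightarrow> ('i, 'a) run \<Rightarrow> real" where
  "path_prob C \<tau> h \<pi> =
     (\<Prod>k<stage \<pi>. pmf (\<tau> (fst h, snd h @ take k (snd \<pi>))) (act_at \<pi> k) *
        trans_prob C (state_at \<pi> k) (act_at \<pi> k) (state_at \<pi> (Suc k)))"

text \<open>In a game, \<open>paths C K h\<close> is finite for every history \<open>h\<close>, even if \<open>Env C\<close> is not: the
  environment moves deterministically and all \<open>Loc C i\<close> are finite.\<close>

definition expect :: "('i::finite, 'a) ns_csg \<Rightarrow> nat \<Rightarrow> ('i, 'a) corr_profile \<Rightarrow> ('i, 'a) run \<Rightarrow>
    (('i, 'a) run \<Rightarrow> real) \<Rightarrow> real" where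
  "expect C K \<tau> h Y = (\<Sum>\<pi>\<in>paths C K h. path_prob C \<tau> h \<pi> * Y \<pi>)"

definition welfare :: "('i::finite, 'a) ns_csg \<Rightarrow> ('i, 'a) rewards \<Rightarrow> nat \<Rightarrow>
    ('i, 'a) corr_profile \<Rightarrow> ('i, 'a) run \<Rightarrow> real" where
  "welfare C r K \<tau> h = expect C K \<tau> h (\<lambda>\<pi>. \<Sum>i\<in>UNIV. payoff r i \<pi>)"

definition spne :: "('i::finite, 'a) ns_csg \<Rightarrow> ('i, 'a) rewards \<Rightarrow> nat \<Rightarrow> 'i gstate \<Rightarrow>
    ('i \<Rightarrow> ('i, 'a) strategy) \<Rightarrow> bool" where
  "spne C r K s \<sigma> \<longleftrightarrow> \<sigma> \<in> strategy_profiles C K \<and>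
     (\<forall>i. \<forall>f \<in> strategies C K i. \<forall>l<K. \<forall>h \<in> hists_from C s l.
        expect C K (indep_profile \<sigma>) h (payoff r i)
          \<ge> expect C K (indep_profile (\<sigma>(i := f))) h (payoff r i))"

text \<open>In \<open>rec_expect\<close>, the recommendation at \<open>h\<close> is drawn from \<open>\<tau> h\<close> conditioned on agent \<open>i\<close>
  being recommended \<open>a\<close>, and \<open>i\<close> then plays \<open>a'\<close> instead; histories record the actions that were
  actually played. Since \<open>h\<close> itself does not occur again later on a path from \<open>h\<close>, the update at
  \<open>h\<close> affects the first step only. The value is meaningful only if \<open>a\<close> has positive probability.\<close>

definition rec_expect :: "('i::finite, 'a) ns_csg \<Rightarrow> ('i, 'a) rewards \<Rightarrow> nat \<Rightarrow>
    ('i, 'a) corr_profile \<Rightarrow> 'i \<Rightarrow> 'a option \<Rightarrow> 'a option \<Rightarrow> ('i, 'a) run \<Rightarrow> real" where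
  "rec_expect C r K \<tau> i a' a h =
     expect C K (\<tau>(h := map_pmf (\<lambda>\<alpha>. \<alpha>(i := a')) (cond_pmf (\<tau> h) {\<alpha>. \<alpha> i = a}))) h (payoff r i)"

definition spce :: "('i::finite, 'a) ns_csg \<Rightarrow> ('i, 'a) rewards \<Rightarrow> nat \<Rightarrow> 'i gstate \<Rightarrow>
    ('i, 'a) corr_profile \<Rightarrow> bool" where
  "spce C r K s \<tau> \<longleftrightarrow> \<tau> \<in> corr_profiles C K \<and>
     (\<forall>i. \<forall>l<K. \<forall>h \<in> hists_from C s l.
        \<forall>a \<in> acts_at C i (last_state h). \<forall>a' \<in> acts_at C i (last_state h).
        measure_pmf.prob (\<tau> h) {\<alpha>. \<alpha> i = a} > 0 \<longrightarrow>
          rec_expect C r K \<tau> i a a h \<ge> rec_expect C r K \<tau> i a' a h)"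

definition sw_spne :: "('i::finite, 'a) ns_csg \<Rightarrow> ('i, 'a) rewards \<Rightarrow> nat \<Rightarrow> 'i gstate \<Rightarrow>
    ('i \<Rightarrow> ('i, 'a) strategy) \<Rightarrow> bool" where
  "sw_spne C r K s \<sigma> \<longleftrightarrow> spne C r K s \<sigma> \<and>
     (\<forall>\<sigma>'. spne C r K s \<sigma>' \<longrightarrow>
        welfare C r K (indep_profile \<sigma>) (init_hist s)
          \<ge> welfare C r K (indep_profile \<sigma>') (init_hist s))"

definition sw_spce :: "('i::finite, 'a) ns_csg \<Rightarrow> ('i, 'a) rewards \<Rightarrow> nat \<Rightarrow> 'i gstate \<Rightarrow>
    ('i, 'a) corr_profile \<Rightarrow> bool" where
  "sw_spce C r K s \<tau> \<longleftrightarrow> spce C r K s \<tau> \<and>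
     (\<forall>\<tau>'. spce C r K s \<tau>' \<longrightarrow>
        welfare C r K \<tau> (init_hist s) \<ge> welfare C r K \<tau>' (init_hist s))"

text \<open>Constraint systems. The variables are families \<open>V h i\<close>, \<open>\<mu> i h a\<close> and \<open>\<mu> h \<alpha>\<close>, of which
  only the members with \<open>h \<in> dec_hists_from C K s\<close>, \<open>a \<in> acts_at C i (last_state h)\<close> and
  \<open>\<alpha> \<in> jacts_at C (last_state h)\<close> are used; \<open>value_at\<close> puts the constants at stage \<open>K\<close>.\<close>

type_synonym ('i, 'a) valuation = "('i, 'a) run \<Rightarrow> 'i \<Rightarrow> real"
type_synonym ('i, 'a) mu_nash = "'i \<Rightarrow> ('i, 'a) run \<Rightarrow> 'a option \<Rightarrow> real"
type_synonym ('i, 'a) mu_corr = "('i, 'a) run \<Rightarrow> ('i, 'a) jact \<Rightarrow> real"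

definition value_at :: "('i, 'a) rewards \<Rightarrow> nat \<Rightarrow> ('i, 'a) valuation \<Rightarrow> ('i, 'a) valuation" where
  "value_at r K V h i = (if stage h = K then state_rew r i (last_state h) else V h i)"

definition succ_states ::
    "('i::finite, 'a) ns_csg \<Rightarrow> 'i gstate \<Rightarrow> ('i, 'a) jact \<Rightarrow> 'i gstate set" where
  "succ_states C s \<alpha> = {s' \<in> gstates C. trans_prob C s \<alpha> s' > 0}"

definition Z :: "('i::finite, 'a) ns_csg \<Rightarrow> ('i, 'a) rewards \<Rightarrow> nat \<Rightarrow> ('i, 'a) valuation \<Rightarrow>
    'i \<Rightarrow> ('i, 'a) run \<Rightarrow> ('i, 'a) jact \<Rightarrow> real" where
  "Z C r K V i h \<alpha> =
     act_rew r i (last_state h) \<alpha> + state_rew r i (last_state h)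
       + (\<Sum>s'\<in>succ_states C (last_state h) \<alpha>.
            trans_prob C (last_state h) \<alpha> s' * value_at r K V (ext_hist h \<alpha> s') i)"

text \<open>With two agents \<open>i \<noteq> j\<close>, \<open>joint i a b\<close> is the joint action in which \<open>i\<close> plays \<open>a\<close> and
  \<open>j\<close> plays \<open>b\<close>.\<close>

definition joint :: "'i \<Rightarrow> 'a option \<Rightarrow> 'a option \<Rightarrow> ('i, 'a) jact" where
  "joint i a b = (\<lambda>k. if k = i then a else b)"

definition constr_N :: "('i::finite, 'a) ns_csg \<Rightarrow> ('i, 'a) rewards \<Rightarrow> nat \<Rightarrow> 'i gstate \<Rightarrow>
    ('i, 'a) mu_nash \<Rightarrow> ('i, 'a) valuation \<Rightarrow> bool" where
  "constr_N C r K s \<mu> V \<longleftrightarrow>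
     (\<forall>h \<in> dec_hists_from C K s. \<forall>i j. i \<noteq> j \<longrightarrow>
        (let Ai = acts_at C i (last_state h); Aj = acts_at C j (last_state h) in
         V h i - (\<Sum>(a, b)\<in>Ai \<times> Aj. \<mu> i h a * \<mu> j h b * Z C r K V i h (joint i a b)) = 0 \<and>
         (\<forall>a \<in> Ai. V h i - (\<Sum>b\<in>Aj. \<mu> j h b * Z C r K V i h (joint i a b)) \<ge> 0) \<and>
         (\<Sum>a\<in>Ai. \<mu> i h a) = 1 \<and> (\<forall>a \<in> Ai. \<mu> i h a \<ge> 0)))"

definition constr_C :: "('i::finite, 'a) ns_csg \<Rightarrow> ('i, 'a) rewards \<Rightarrow> nat \<Rightarrow> 'i gstate \<Rightarrow>
    ('i, 'a) mu_corr \<Rightarrow> ('i, 'a) valuation \<Rightarrow> bool" where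
  "constr_C C r K s \<mu> V \<longleftrightarrow>
     (\<forall>h \<in> dec_hists_from C K s. \<forall>i j. i \<noteq> j \<longrightarrow>
        (let Ai = acts_at C i (last_state h); Aj = acts_at C j (last_state h);
             A = jacts_at C (last_state h) in
         V h i - (\<Sum>\<alpha>\<in>A. \<mu> h \<alpha> * Z C r K V i h \<alpha>) = 0 \<and>
         (\<forall>a \<in> Ai. \<forall>a' \<in> Ai.
            (\<Sum>b\<in>Aj. (Z C r K V i h (joint i a b) - Z C r K V i h (joint i a' b))
                       * \<mu> h (joint i a b)) \<ge> 0) \<and>
         (\<Sum>\<alpha>\<in>A. \<mu> h \<alpha>) = 1 \<and> (\<forall>\<alpha> \<in> A. \<mu> h \<alpha> \<ge> 0)))"

definition objective :: "'i::finite gstate \<Rightarrow> ('i, 'a) valuation \<Rightarrow> real" where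
  "objective s V = (\<Sum>i\<in>UNIV. V (init_hist s) i)"

definition optimal_N :: "('i::finite, 'a) ns_csg \<Rightarrow> ('i, 'a) rewards \<Rightarrow> nat \<Rightarrow> 'i gstate \<Rightarrow>
    ('i, 'a) mu_nash \<Rightarrow> ('i, 'a) valuation \<Rightarrow> bool" where
  "optimal_N C r K s \<mu> V \<longleftrightarrow> constr_N C r K s \<mu> V \<and>
     (\<forall>\<mu>' V'. constr_N C r K s \<mu>' V' \<longrightarrow> objective s V' \<le> objective s V)"

definition optimal_C :: "('i::finite, 'a) ns_csg \<Rightarrow> ('i, 'a) rewards \<Rightarrow> nat \<Rightarrow> 'i gstate \<Rightarrow>
    ('i, 'a) mu_corr \<Rightarrow> ('i, 'a) valuation \<Rightarrow> bool" where
  "optimal_C C r K s \<mu> V \<longleftrightarrow> constr_C C r K s \<mu> V \<and>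
     (\<forall>\<mu>' V'. constr_C C r K s \<mu>' V' \<longrightarrow> objective s V' \<le> objective s V)"

definition agrees_N :: "('i::finite, 'a) ns_csg \<Rightarrow> nat \<Rightarrow> 'i gstate \<Rightarrow>
    ('i \<Rightarrow> ('i, 'a) strategy) \<Rightarrow> ('i, 'a) mu_nash \<Rightarrow> bool" where
  "agrees_N C K s \<sigma> \<mu> \<longleftrightarrow>
     (\<forall>h \<in> dec_hists_from C K s. \<forall>i. \<forall>a \<in> acts_at C i (last_state h). pmf (\<sigma> i h) a = \<mu> i h a)"

definition agrees_C :: "('i::finite, 'a) ns_csg \<Rightarrow> nat \<Rightarrow> 'i gstate \<Rightarrow>
    ('i, 'a) corr_profile \<Rightarrow> ('i, 'a) mu_corr \<Rightarrow> bool" where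
  "agrees_C C K s \<tau> \<mu> \<longleftrightarrow>
     (\<forall>h \<in> dec_hists_from C K s. \<forall>\<alpha> \<in> jacts_at C (last_state h). pmf (\<tau> h) \<alpha> = \<mu> h \<alpha>)"

end

theory Submission
  imports Defs
begin

text \<open>
  The value \<open>profile_value\<close> of a profile satisfies the one-stage recursion whose right-hand side
  is the average of \<open>Z\<close>, and backward induction on the stage shows that this recursion has only
  one solution; so \<open>V\<close> in a solution of either constraint system is the value of the profile.
  The incentive constraints are then the absence of profitable one-shot deviations. For correlated
  equilibria this is the definition, multiplied by the probability of the recommendation. For Nash
  equilibria, backward induction extends it to arbitrary deviations. Conversely every solution
  is realised by a profile, so maximising welfare over equilibria is maximising the objective.
\<close>

section \<open>Runs and histories\<close>

lemma stage_simps [simp]: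
  "stage (s, []) = 0" "stage (s, x # xs) = Suc (stage (snd x, xs))"
  "stage (ext_hist h \<alpha> s') = Suc (stage h)"
  by (auto simp: stage_def ext_hist_def)

lemma state_at_simps [simp]:
  "state_at (s, xs) 0 = s" "state_at (s, (\<alpha>, s') # xs) (Suc k) = state_at (s', xs) k"
  by (auto simp: state_at_def)

lemma act_at_simps [simp]:
  "act_at (s, (\<alpha>, s') # xs) 0 = \<alpha>" "act_at (s, (\<alpha>, s') # xs) (Suc k) = act_at (s', xs) k"
  by (auto simp: act_at_def)

lemma last_state_simps [simp]:
  "last_state (s, []) = s" "last_state (s, (\<alpha>, s') # xs) = last_state (s', xs)"
  "last_state (ext_hist h \<alpha> s') = s'"
  by (auto simp: last_state_def ext_hist_def state_at_def stage_def nth_append nth_Cons')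

lemma ext_hist_simps [simp]:
  "fst (ext_hist h \<alpha> s') = fst h" "snd (ext_hist h \<alpha> s') = snd h @ [(\<alpha>, s')]"
  by (auto simp: ext_hist_def)

lemma is_run_Nil [simp]: "is_run C (s, []) \<longleftrightarrow> s \<in> gstates C"
  by (auto simp: is_run_def)

lemma is_run_Cons [simp]:
  "is_run C (s, (\<alpha>, s') # xs) \<longleftrightarrow>
     s \<in> gstates C \<and> \<alpha> \<in> jacts_at C s \<and> trans_prob C s \<alpha> s' > 0 \<and> is_run C (s', xs)"
proof -
  have le: "(\<forall>k\<le>Suc n. P k) \<longleftrightarrow> P 0 \<and> (\<forall>k\<le>n. P (Suc k))" for P n
    by (metis le0 less_Suc_eq_0_disj less_Suc_eq_le)
  have lt: "(\<forall>k<Suc n. P k) \<longleftrightarrow> P 0 \<and> (\<forall>k<n. P (Suc k))" for P n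
    by (metis less_Suc_eq_0_disj)
  show ?thesis
    by (auto simp: is_run_def le lt)
qed

text \<open>Histories grow at the end of the list, whereas \<open>is_run_Cons\<close> unfolds a run
  from the front. Induction on the list connects the two directions.\<close>

lemma is_run_ext_hist:
  "is_run C (ext_hist h \<alpha> s') \<longleftrightarrow>
     is_run C h \<and> \<alpha> \<in> jacts_at C (last_state h) \<and> s' \<in> succ_states C (last_state h) \<alpha>"
proof (cases h)
  case (Pair s xs)
  have "is_run C (s, xs @ [(\<alpha>, s')]) \<longleftrightarrow> is_run C (s, xs) \<and> \<alpha> \<in> jacts_at C (last_state (s, xs)) \<and>
     s' \<in> succ_states C (last_state (s, xs)) \<alpha>"
    by (induction xs arbitrary: s) (auto simp: succ_states_def)
  then show ?thesis
    by (simp add: Pair ext_hist_def)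
qed

lemma is_run_last_state: "is_run C h \<Longrightarrow> last_state h \<in> gstates C"
  by (auto simp: is_run_def last_state_def)

lemma mem_dec_hists: "h \<in> dec_hists C K \<longleftrightarrow> is_run C h \<and> stage h < K"
  by (auto simp: dec_hists_def hists_def)

lemma mem_dec_hists_from: "h \<in> dec_hists_from C K s \<longleftrightarrow> is_run C h \<and> stage h < K \<and> fst h = s"
  by (auto simp: dec_hists_from_def hists_from_def hists_def)

section \<open>Available actions and transition probabilities\<close>

lemma finite_acts_at:
  assumes "is_ns_csg C" "s \<in> gstates C"
  shows "finite (acts_at C i s)"
proof -
  have "avail C i (fst s i) \<subseteq> Act C i" "finite (Act C i)"
    using assms by (auto simp: is_ns_csg_def gstates_def)
  then show ?thesis
    by (auto simp: acts_at_def intro: finite_subset)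
qed

lemma acts_at_nonempty: "acts_at C i s \<noteq> {}"
  by (auto simp: acts_at_def)

lemma jacts_at_eq_PiE: "jacts_at C s = PiE UNIV (\<lambda>i. acts_at C i s)"
  by (auto simp: jacts_at_def PiE_def Pi_def)

lemma finite_jacts_at:
  assumes "is_ns_csg C" "s \<in> gstates C"
  shows "finite (jacts_at C s)"
  unfolding jacts_at_eq_PiE by (intro finite_PiE finite_acts_at assms) auto

text \<open>The closure conditions on \<open>ltrans\<close> and \<open>etrans\<close> in
  \<open>is_ns_csg\<close> are stated for \<open>jacts\<close>; this carries them over to available
  joint actions.\<close>

lemma jacts_at_subset_jacts:
  assumes "is_ns_csg C" "s \<in> gstates C"
  shows "jacts_at C s \<subseteq> jacts C"
proof
  fix \<alpha> assume "\<alpha> \<in> jacts_at C s"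
  moreover have "avail C i (fst s i) \<subseteq> Act C i" for i
    using assms by (auto simp: is_ns_csg_def gstates_def)
  ultimately show "\<alpha> \<in> jacts C"
    by (fastforce simp: jacts_at_def jacts_def acts_at_def split: if_splits)
qed

lemma trans_prob_nonneg: "trans_prob C s \<alpha> s' \<ge> 0"
  by (auto simp: trans_prob_def intro: prod_nonneg)

text \<open>Percepts and environment move deterministically, so a successor is determined by the
  vector of new locations, which ranges over the finite product \<open>L\<close>. Summing over
  \<open>L\<close> gives a product of total masses.\<close>

lemma
  assumes "is_ns_csg C" "s \<in> gstates C" "\<alpha> \<in> jacts_at C s"
  shows finite_succ_states: "finite (succ_states C s \<alpha>)"
    and sum_trans_prob: "(\<Sum>s'\<in>succ_states C s \<alpha>. trans_prob C s \<alpha> s') = 1"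
proof -
  define next_state where "next_state l = ((\<lambda>i. (l i, obs C i s)), etrans C (snd s) \<alpha>)" for l :: "_ \<Rightarrow> real list"
  define L where "L = PiE UNIV (Loc C)"
  have finL: "finite L"
    using assms(1) unfolding L_def by (intro finite_PiE) (auto simp: is_ns_csg_def)
  have \<alpha>: "\<alpha> \<in> jacts C"
    using assms jacts_at_subset_jacts by blast
  have inj: "inj_on next_state L"
    by (auto simp: inj_on_def next_state_def fun_eq_iff)
  \<comment> \<open>Positive probability forces the percepts and the environment component, so
    \<open>s'\<close> is recovered from its locations.\<close>
  have sub: "succ_states C s \<alpha> \<subseteq> next_state ` L"
  proof
    fix s' assume "s' \<in> succ_states C s \<alpha>"
    then have s': "s' \<in> gstates C" "trans_prob C s \<alpha> s' > 0"
      by (auto simp: succ_states_def)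
    then have "s' = next_state (\<lambda>i. fst (fst s' i))"
      by (cases s') (auto simp: trans_prob_def next_state_def fun_eq_iff prod_eq_iff split: if_splits)
    moreover have "(\<lambda>i. fst (fst s' i)) \<in> L"
      using s'(1) by (auto simp: L_def gstates_def lstates_def mem_Times_iff)
    ultimately show "s' \<in> next_state ` L"
      by blast
  qed
  show "finite (succ_states C s \<alpha>)"
    using finite_subset[OF sub] finL by blast
  have obs: "obs C i s \<in> Per C i" for i
    using assms(1,2) by (simp add: is_ns_csg_def)
  then have lstate: "(fst (fst s i), obs C i s) \<in> lstates C i" for i
    using assms(2) by (simp add: gstates_def lstates_def mem_Times_iff)
  have "next_state l \<in> gstates C" if "l \<in> L" for l
    using assms(1,2) \<alpha> obs that
    by (auto simp: next_state_def L_def gstates_def lstates_def is_ns_csg_def)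
  \<comment> \<open>The image lies in \<open>gstates C\<close>, so a member of it that is not a
    successor has probability 0 and can be added to the sum.\<close>
  then have "trans_prob C s \<alpha> s' = 0" if "s' \<in> next_state ` L - succ_states C s \<alpha>" for s'
    using that trans_prob_nonneg[of C s \<alpha> s'] by (fastforce simp: succ_states_def)
  then have "(\<Sum>s'\<in>succ_states C s \<alpha>. trans_prob C s \<alpha> s') = (\<Sum>s'\<in>next_state ` L. trans_prob C s \<alpha> s')"
    using finL by (intro sum.mono_neutral_left sub) auto
  also have "\<dots> = (\<Sum>l\<in>L. \<Prod>i\<in>UNIV. pmf (ltrans C i (fst (fst s i), obs C i s) \<alpha>) (l i))"
    by (simp add: sum.reindex[OF inj]) (simp add: trans_prob_def next_state_def)
  \<comment> \<open>The new locations are drawn independently, so the sum over vectors factors agent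
    by agent.\<close>
  also have "\<dots> = (\<Prod>i\<in>UNIV. \<Sum>x\<in>Loc C i. pmf (ltrans C i (fst (fst s i), obs C i s) \<alpha>) x)"
    using assms(1) unfolding L_def by (subst prod_sum_PiE) (auto simp: is_ns_csg_def)
  also have "\<dots> = 1"
    using assms(1) lstate \<alpha> by (intro prod.neutral ballI sum_pmf_eq_1) (auto simp: is_ns_csg_def)
  finally show "(\<Sum>s'\<in>succ_states C s \<alpha>. trans_prob C s \<alpha> s') = 1" .
qed

section \<open>Paths and expectations\<close>

definition path_Cons where
  "path_Cons s \<alpha> \<pi> = (s, (\<alpha>, fst \<pi>) # snd \<pi>)"

lemma paths_stage_eq: "is_run C h \<Longrightarrow> stage h = K \<Longrightarrow> paths C K h = {(last_state h, [])}"
  using is_run_last_state[of C h] by (auto simp: paths_def stage_def)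

text \<open>Splits off the first transition. Since strategies see the whole history, the rest is
  indexed by the extended history, and the horizon \<open>K\<close> stays fixed.\<close>

lemma paths_step:
  assumes "is_run C h" "stage h < K"
  shows "paths C K h =
    (\<lambda>(\<alpha>, s', \<pi>). path_Cons (last_state h) \<alpha> \<pi>) `
      (SIGMA \<alpha>:jacts_at C (last_state h). SIGMA s':succ_states C (last_state h) \<alpha>.
         paths C K (ext_hist h \<alpha> s'))"
    (is "_ = ?f ` ?S")
proof (intro equalityI subsetI)
  fix \<pi> assume \<pi>: "\<pi> \<in> paths C K h"
  then obtain \<alpha> s' xs where eq: "\<pi> = (last_state h, (\<alpha>, s') # xs)"
    using assms(2) by (cases \<pi>; cases "snd \<pi>") (auto simp: paths_def stage_def)
  have "is_run C (s', xs)"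
    using \<pi> by (simp add: paths_def eq)
  then have "s' \<in> gstates C"
    by (auto simp: is_run_def)
  then have "(\<alpha>, s', (s', xs)) \<in> ?S"
    using \<pi> by (auto simp: paths_def eq succ_states_def)
  moreover have "\<pi> = ?f (\<alpha>, s', (s', xs))"
    by (simp add: eq path_Cons_def)
  ultimately show "\<pi> \<in> ?f ` ?S"
    by blast
next
  fix \<pi> assume "\<pi> \<in> ?f ` ?S"
  then show "\<pi> \<in> paths C K h"
    using is_run_last_state[OF assms(1)]
    by (auto simp: paths_def path_Cons_def succ_states_def)
qed

text \<open>Backward induction on the number \<open>K - stage h\<close> of remaining stages, a
  pattern that recurs below: each step offers finitely many joint actions and successors.\<close>

lemma finite_paths:
  assumes "is_ns_csg C" "is_run C h" "stage h \<le> K"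
  shows "finite (paths C K h)"
  using assms(3,2)
proof (induction h rule: measure_induct_rule[where f = "\<lambda>h. K - stage h"])
  case (less h)
  show ?case
  proof (cases "stage h = K")
    case True
    then show ?thesis
      using less.prems by (simp add: paths_stage_eq)
  next
    case False
    then have "stage h < K"
      using less.prems by simp
    moreover have "last_state h \<in> gstates C"
      using less.prems is_run_last_state by blast
    ultimately show ?thesis
      using less assms(1) by (subst paths_step)
        (auto intro!: finite_imageI finite_SigmaI finite_jacts_at finite_succ_states less.IH
          simp: is_run_ext_hist)
  qed
qed

text \<open>Decision \<open>Suc k\<close> on the longer path and decision \<open>k\<close> on the
  shorter one are taken at the same history, so only the first factor splits off.\<close>

lemma path_prob_path_Cons:
  "path_prob C \<tau> h (path_Cons (last_state h) \<alpha> \<pi>) =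
     pmf (\<tau> h) \<alpha> * trans_prob C (last_state h) \<alpha> (fst \<pi>) * path_prob C \<tau> (ext_hist h \<alpha> (fst \<pi>)) \<pi>"
  by (cases \<pi>) (simp add: path_prob_def path_Cons_def prod.lessThan_Suc_shift del: prod.lessThan_Suc)

lemma expect_stage_eq:
  "is_run C h \<Longrightarrow> stage h = K \<Longrightarrow> expect C K \<tau> h Y = Y (last_state h, [])"
  by (simp add: expect_def paths_stage_eq path_prob_def)

lemma expect_step:
  assumes "is_ns_csg C" "is_run C h" "stage h < K"
  shows "expect C K \<tau> h Y =
    (\<Sum>\<alpha>\<in>jacts_at C (last_state h). pmf (\<tau> h) \<alpha> *
       (\<Sum>s'\<in>succ_states C (last_state h) \<alpha>. trans_prob C (last_state h) \<alpha> s' *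
          expect C K \<tau> (ext_hist h \<alpha> s') (\<lambda>\<pi>. Y (path_Cons (last_state h) \<alpha> \<pi>))))"
proof -
  let ?A = "jacts_at C (last_state h)" and ?S = "succ_states C (last_state h)"
  let ?P = "\<lambda>\<alpha> s'. paths C K (ext_hist h \<alpha> s')"
  let ?g = "\<lambda>\<alpha> s' \<pi>. pmf (\<tau> h) \<alpha> * trans_prob C (last_state h) \<alpha> s' *
    path_prob C \<tau> (ext_hist h \<alpha> s') \<pi> * Y (path_Cons (last_state h) \<alpha> \<pi>)"
  have last: "last_state h \<in> gstates C"
    using assms(2) by (rule is_run_last_state)
  have fst_path: "fst \<pi> = s'" if "\<pi> \<in> ?P \<alpha> s'" for \<pi> \<alpha> s'
    using that by (simp add: paths_def)
  \<comment> \<open>The state \<open>s'\<close> does not enter \<open>path_Cons\<close> as an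
    argument, but it is the first state of \<open>\<pi>\<close>, so the triple can be
    recovered.\<close>
  have inj: "inj_on (\<lambda>(\<alpha>, s', \<pi>). path_Cons (last_state h) \<alpha> \<pi>)
      (SIGMA \<alpha>:?A. SIGMA s':?S \<alpha>. ?P \<alpha> s')"
    by (auto simp: inj_on_def path_Cons_def dest!: fst_path)
  have fin: "finite (?P \<alpha> s')" if "\<alpha> \<in> ?A" "s' \<in> ?S \<alpha>" for \<alpha> s'
    using that assms by (intro finite_paths) (auto simp: is_run_ext_hist)
  have "expect C K \<tau> h Y = (\<Sum>(\<alpha>, s', \<pi>)\<in>(SIGMA \<alpha>:?A. SIGMA s':?S \<alpha>. ?P \<alpha> s'). ?g \<alpha> s' \<pi>)"
    unfolding expect_def paths_step[OF assms(2,3)] sum.reindex[OF inj]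
    by (intro sum.cong) (auto simp: path_prob_path_Cons dest!: fst_path)
  also have "\<dots> = (\<Sum>\<alpha>\<in>?A. \<Sum>(s', \<pi>)\<in>(SIGMA s':?S \<alpha>. ?P \<alpha> s'). ?g \<alpha> s' \<pi>)"
    using assms last fin
    by (subst sum.Sigma) (auto intro!: finite_jacts_at finite_succ_states finite_SigmaI)
  also have "\<dots> = (\<Sum>\<alpha>\<in>?A. \<Sum>s'\<in>?S \<alpha>. \<Sum>\<pi>\<in>?P \<alpha> s'. ?g \<alpha> s' \<pi>)"
    using assms last fin
    by (intro sum.cong refl, subst sum.Sigma) (auto intro!: finite_succ_states)
  finally show ?thesis
    by (simp add: expect_def sum_distrib_left mult.assoc)
qed

text \<open>Every decision on a path from \<open>h\<close> is taken at an extension of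
  \<open>h\<close>, so the profile matters only there.\<close>

lemma expect_cong:
  assumes "\<And>xs. \<tau> (fst h, snd h @ xs) = \<tau>' (fst h, snd h @ xs)"
  shows "expect C K \<tau> h Y = expect C K \<tau>' h Y"
  by (simp add: expect_def path_prob_def assms)

lemma expect_add:
  "expect C K \<tau> h (\<lambda>\<pi>. X \<pi> + Y \<pi>) = expect C K \<tau> h X + expect C K \<tau> h Y"
  by (simp add: expect_def distrib_left sum.distrib)

lemma expect_sum:
  "expect C K \<tau> h (\<lambda>\<pi>. \<Sum>i\<in>I. Y i \<pi>) = (\<Sum>i\<in>I. expect C K \<tau> h (Y i))"
  unfolding expect_def sum_distrib_left by (rule sum.swap)

text \<open>The path probabilities sum to 1, because at each stage both the choice of an available
  joint action and the transition have total mass 1. This lets stage rewards be taken out of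
  expectations.\<close>

lemma expect_const:
  assumes "is_ns_csg C" "\<tau> \<in> corr_profiles C K" "is_run C h" "stage h \<le> K"
  shows "expect C K \<tau> h (\<lambda>_. c) = c"
  using assms(4,3)
proof (induction h rule: measure_induct_rule[where f = "\<lambda>h. K - stage h"])
  case (less h)
  show ?case
  proof (cases "stage h = K")
    case True
    then show ?thesis
      using less.prems by (simp add: expect_stage_eq)
  next
    case False
    then have lt: "stage h < K"
      using less.prems by simp
    have last: "last_state h \<in> gstates C"
      using less.prems is_run_last_state by blast
    have "expect C K \<tau> h (\<lambda>_. c) =
        (\<Sum>\<alpha>\<in>jacts_at C (last_state h). pmf (\<tau> h) \<alpha> *
          (\<Sum>s'\<in>succ_states C (last_state h) \<alpha>. trans_prob C (last_state h) \<alpha> s' * c))"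
      using less lt assms(1) by (subst expect_step) (auto simp: is_run_ext_hist intro!: sum.cong)
    also have "\<dots> = (\<Sum>\<alpha>\<in>jacts_at C (last_state h). pmf (\<tau> h) \<alpha>) * c"
      using assms(1) last by (simp add: sum_trans_prob flip: sum_distrib_right)
    also have "(\<Sum>\<alpha>\<in>jacts_at C (last_state h). pmf (\<tau> h) \<alpha>) = 1"
      using assms(1,2) less.prems lt last
      by (intro sum_pmf_eq_1 finite_jacts_at) (auto simp: corr_profiles_def mem_dec_hists)
    finally show ?thesis
      by simp
  qed
qed

section \<open>The value of a profile and its one-stage recursion\<close>

lemma payoff_path_Cons:
  "payoff r i (path_Cons s \<alpha> \<pi>) = act_rew r i s \<alpha> + state_rew r i s + payoff r i \<pi>"
  by (cases \<pi>) (simp add: payoff_def path_Cons_def sum.lessThan_Suc_shift del: sum.lessThan_Suc)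

text \<open>The argument order is that of \<open>valuation\<close>, so that a value can take the
  place of \<open>V\<close> in \<open>Z\<close> and in the constraint systems.\<close>

definition profile_value ::
    "('i::finite, 'a) ns_csg \<Rightarrow> ('i, 'a) rewards \<Rightarrow> nat \<Rightarrow> ('i, 'a) corr_profile \<Rightarrow> ('i, 'a) valuation"
  where "profile_value C r K \<tau> h i = expect C K \<tau> h (payoff r i)"

lemma welfare_eq_sum_value: "welfare C r K \<tau> h = (\<Sum>i\<in>UNIV. profile_value C r K \<tau> h i)"
  by (simp add: welfare_def profile_value_def expect_sum)

text \<open>At stage \<open>K\<close> the only path is the empty one, whose payoff is the final
  state reward, so the override in \<open>value_at\<close> changes nothing.\<close>

lemma value_at_profile_value:
  "is_run C h \<Longrightarrow> value_at r K (profile_value C r K \<tau>) h i = profile_value C r K \<tau> h i"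
  by (auto simp: value_at_def profile_value_def expect_stage_eq payoff_def)

lemma Z_cong:
  assumes "\<And>s'. s' \<in> succ_states C (last_state h) \<alpha> \<Longrightarrow>
    value_at r K V (ext_hist h \<alpha> s') i = value_at r K V' (ext_hist h \<alpha> s') i"
  shows "Z C r K V i h \<alpha> = Z C r K V' i h \<alpha>"
  using assms by (simp add: Z_def)

lemma Z_mono:
  assumes "\<And>s'. s' \<in> succ_states C (last_state h) \<alpha> \<Longrightarrow>
    value_at r K V (ext_hist h \<alpha> s') i \<le> value_at r K V' (ext_hist h \<alpha> s') i"
  shows "Z C r K V i h \<alpha> \<le> Z C r K V' i h \<alpha>"
  using assms by (auto simp: Z_def trans_prob_nonneg intro!: sum_mono mult_left_mono)

text \<open>The Bellman equation for a fixed profile, obtained from \<open>expect_step\<close> by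
  separating the current rewards from the rest of the payoff.\<close>

lemma profile_value_step:
  assumes "is_ns_csg C" "\<tau> \<in> corr_profiles C K" "is_run C h" "stage h < K"
  shows "profile_value C r K \<tau> h i =
    (\<Sum>\<alpha>\<in>jacts_at C (last_state h). pmf (\<tau> h) \<alpha> * Z C r K (profile_value C r K \<tau>) i h \<alpha>)"
proof -
  have last: "last_state h \<in> gstates C"
    using assms(3) by (rule is_run_last_state)
  have "(\<Sum>s'\<in>succ_states C (last_state h) \<alpha>. trans_prob C (last_state h) \<alpha> s' *
      expect C K \<tau> (ext_hist h \<alpha> s') (\<lambda>\<pi>. payoff r i (path_Cons (last_state h) \<alpha> \<pi>))) =
      Z C r K (profile_value C r K \<tau>) i h \<alpha>" (is "?L = _")
    if "\<alpha> \<in> jacts_at C (last_state h)" for \<alpha>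
  proof -
    let ?c = "act_rew r i (last_state h) \<alpha> + state_rew r i (last_state h)"
    \<comment> \<open>The current reward \<open>?c\<close> is the same on all continuations, so
      \<open>expect_add\<close> and \<open>expect_const\<close> move it outside.\<close>
    have "?L = (\<Sum>s'\<in>succ_states C (last_state h) \<alpha>. trans_prob C (last_state h) \<alpha> s' *
        (?c + value_at r K (profile_value C r K \<tau>) (ext_hist h \<alpha> s') i))"
      using that assms by (intro sum.cong refl)
        (simp add: payoff_path_Cons expect_add expect_const is_run_ext_hist value_at_profile_value,
         simp add: profile_value_def)
    also have "\<dots> = (\<Sum>s'\<in>succ_states C (last_state h) \<alpha>. trans_prob C (last_state h) \<alpha> s') * ?c +
        (\<Sum>s'\<in>succ_states C (last_state h) \<alpha>. trans_prob C (last_state h) \<alpha> s' *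
          value_at r K (profile_value C r K \<tau>) (ext_hist h \<alpha> s') i)"
      by (simp add: distrib_left sum.distrib sum_distrib_right)
    finally show ?thesis
      using assms(1) last that by (simp add: sum_trans_prob Z_def)
  qed
  then show ?thesis
    using assms unfolding profile_value_def by (subst expect_step) auto
qed

text \<open>Backward induction with the monotonicity of \<open>Z\<close>: a supersolution of the
  recursion bounds the value from above. This is what extends a bound on one-shot deviations to
  deviations at many histories.\<close>

lemma profile_value_le:
  assumes "is_ns_csg C" "\<tau> \<in> corr_profiles C K"
    and V: "\<And>h. h \<in> dec_hists_from C K s \<Longrightarrow>
      (\<Sum>\<alpha>\<in>jacts_at C (last_state h). pmf (\<tau> h) \<alpha> * Z C r K V i h \<alpha>) \<le> V h i"
    and "is_run C h" "stage h \<le> K" "fst h = s"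
  shows "profile_value C r K \<tau> h i \<le> value_at r K V h i"
  using assms(4-6)
proof (induction h rule: measure_induct_rule[where f = "\<lambda>h. K - stage h"])
  case (less h)
  show ?case
  proof (cases "stage h = K")
    case True
    then show ?thesis
      using less.prems value_at_profile_value[of C h r K \<tau> i] by (simp add: value_at_def)
  next
    case False
    then have lt: "stage h < K"
      using less.prems by simp
    have "profile_value C r K \<tau> h i =
        (\<Sum>\<alpha>\<in>jacts_at C (last_state h). pmf (\<tau> h) \<alpha> * Z C r K (profile_value C r K \<tau>) i h \<alpha>)"
      using assms(1,2) less.prems lt by (intro profile_value_step)
    also have "\<dots> \<le> (\<Sum>\<alpha>\<in>jacts_at C (last_state h). pmf (\<tau> h) \<alpha> * Z C r K V i h \<alpha>)"
      using less lt by (intro sum_mono mult_left_mono Z_mono)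
        (auto simp: is_run_ext_hist value_at_profile_value)
    also have "\<dots> \<le> V h i"
      using less.prems lt by (intro V) (simp add: mem_dec_hists_from)
    finally show ?thesis
      using False by (simp add: value_at_def)
  qed
qed

text \<open>The same induction with equalities. Extending a history keeps its first state, so the
  recursion is needed only at histories from \<open>s\<close>.\<close>

lemma profile_value_unique:
  assumes "is_ns_csg C" "\<tau> \<in> corr_profiles C K"
    and V: "\<And>h. h \<in> dec_hists_from C K s \<Longrightarrow>
      V h i = (\<Sum>\<alpha>\<in>jacts_at C (last_state h). pmf (\<tau> h) \<alpha> * Z C r K V i h \<alpha>)"
    and "is_run C h" "stage h \<le> K" "fst h = s"
  shows "value_at r K V h i = profile_value C r K \<tau> h i"
  using assms(4-6)
proof (induction h rule: measure_induct_rule[where f = "\<lambda>h. K - stage h"])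
  case (less h)
  show ?case
  proof (cases "stage h = K")
    case True
    then show ?thesis
      using less.prems value_at_profile_value[of C h r K \<tau> i] by (simp add: value_at_def)
  next
    case False
    then have lt: "stage h < K"
      using less.prems by simp
    have "profile_value C r K \<tau> h i =
        (\<Sum>\<alpha>\<in>jacts_at C (last_state h). pmf (\<tau> h) \<alpha> * Z C r K (profile_value C r K \<tau>) i h \<alpha>)"
      using assms(1,2) less.prems lt by (intro profile_value_step)
    also have "\<dots> = (\<Sum>\<alpha>\<in>jacts_at C (last_state h). pmf (\<tau> h) \<alpha> * Z C r K V i h \<alpha>)"
      using less lt by (intro sum.cong refl arg_cong2[where f = "(*)"] Z_cong)
        (auto simp: is_run_ext_hist value_at_profile_value)
    also have "\<dots> = V h i"
      using less.prems lt by (intro V[symmetric]) (simp add: mem_dec_hists_from)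
    finally show ?thesis
      using False by (simp add: value_at_def)
  qed
qed

text \<open>Histories after \<open>h\<close> are strictly longer than \<open>h\<close>, so a change
  at \<open>h\<close> alone leaves all continuation values those of \<open>\<tau>\<close>.\<close>

lemma profile_value_one_shot:
  assumes "is_ns_csg C" "\<tau>' \<in> corr_profiles C K" "is_run C h" "stage h < K"
    and agree: "\<And>h'. h' \<noteq> h \<Longrightarrow> \<tau>' h' = \<tau> h'"
  shows "profile_value C r K \<tau>' h i =
    (\<Sum>\<alpha>\<in>jacts_at C (last_state h). pmf (\<tau>' h) \<alpha> * Z C r K (profile_value C r K \<tau>) i h \<alpha>)"
proof -
  have "value_at r K (profile_value C r K \<tau>') (ext_hist h \<alpha> s') i =
      value_at r K (profile_value C r K \<tau>) (ext_hist h \<alpha> s') i" for \<alpha> s'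
    unfolding value_at_def profile_value_def
    by (subst expect_cong[of \<tau>' _ \<tau>]) (auto intro!: agree simp: prod_eq_iff)
  then have "Z C r K (profile_value C r K \<tau>') i h \<alpha> = Z C r K (profile_value C r K \<tau>) i h \<alpha>" for \<alpha>
    by (intro Z_cong)
  then show ?thesis
    using profile_value_step[OF assms(1-4)] by simp
qed

section \<open>Joint actions and independent play of two agents\<close>

lemma two_agents_UNIV:
  assumes "CARD('i::finite) = 2" "i \<noteq> (j::'i)"
  shows "UNIV = {i, j}"
proof (rule sym, rule card_subset_eq)
  show "card {i, j} = CARD('i)"
    using assms by simp
qed auto

lemma other_agent:
  assumes "CARD('i::finite) = 2"
  obtains j where "(i::'i) \<noteq> j"
  using assms by (metis (full_types) UNIV_I card_2_iff)

lemma all_agents_iff: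
  fixes i j :: "'i::finite"
  assumes "CARD('i) = 2" "i \<noteq> j"
  shows "(\<forall>k. P k) \<longleftrightarrow> P i \<and> P j"
  using two_agents_UNIV[OF assms] by (metis UNIV_I insertE singletonD)

text \<open>With two agents a joint action is a pair of actions, the inverse of the projection being
  \<open>joint i\<close>. This gives the double sums of the constraint systems.\<close>

lemma sum_jacts_at:
  fixes i j :: "'i::finite"
  assumes "CARD('i) = 2" "i \<noteq> j"
  shows "(\<Sum>\<alpha>\<in>jacts_at C s. f \<alpha>) = (\<Sum>a\<in>acts_at C i s. \<Sum>b\<in>acts_at C j s. f (joint i a b))"
proof -
  have joint: "joint i (\<alpha> i) (\<alpha> j) = \<alpha>" for \<alpha> :: "'i \<Rightarrow> 'b option"
    using assms(2) by (simp add: fun_eq_iff all_agents_iff[OF assms] joint_def)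
  have "(\<Sum>\<alpha>\<in>jacts_at C s. f \<alpha>) = (\<Sum>(a, b)\<in>acts_at C i s \<times> acts_at C j s. f (joint i a b))"
    using assms(2)
    by (intro sum.reindex_bij_witness[where j = "\<lambda>\<alpha>. (\<alpha> i, \<alpha> j)" and i = "\<lambda>(a, b). joint i a b"])
      (auto simp: jacts_at_def joint all_agents_iff[OF assms], auto simp: joint_def)
  then show ?thesis
    by (simp add: sum.cartesian_product)
qed

lemma joint_mem_jacts_at:
  fixes i j :: "'i::finite"
  assumes "CARD('i) = 2" "i \<noteq> j" "a \<in> acts_at C i s" "b \<in> acts_at C j s"
  shows "joint i a b \<in> jacts_at C s"
  using assms(2-) by (simp add: jacts_at_def joint_def all_agents_iff[OF assms(1,2)])

lemma pmf_indep_profile_joint: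
  fixes i j :: "'i::finite"
  assumes "CARD('i) = 2" "i \<noteq> j"
  shows "pmf (indep_profile \<sigma> h) (joint i a b) = pmf (\<sigma> i h) a * pmf (\<sigma> j h) b"
proof -
  have "(\<Prod>k\<in>UNIV. g k) = g i * g j" for g :: "'i \<Rightarrow> real"
    using assms(2) by (simp add: two_agents_UNIV[OF assms])
  then show ?thesis
    using assms(2) unfolding indep_profile_def by (subst pmf_Pi') (simp_all add: joint_def)
qed

lemma sum_indep_profile:
  fixes i j :: "'i::finite"
  assumes "CARD('i) = 2" "i \<noteq> j"
  shows "(\<Sum>\<alpha>\<in>jacts_at C s. pmf (indep_profile \<sigma> h) \<alpha> * f \<alpha>) =
    (\<Sum>a\<in>acts_at C i s. pmf (\<sigma> i h) a * (\<Sum>b\<in>acts_at C j s. pmf (\<sigma> j h) b * f (joint i a b)))"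
  by (simp add: sum_jacts_at[OF assms] pmf_indep_profile_joint[OF assms] sum_distrib_left mult.assoc)

text \<open>Independent play is a special case of correlated play, so the results on values apply to
  strategy profiles.\<close>

lemma indep_profile_in_corr_profiles:
  assumes "\<sigma> \<in> strategy_profiles C K"
  shows "indep_profile \<sigma> \<in> corr_profiles C K"
proof -
  have "\<alpha> k \<in> acts_at C k (last_state h)"
    if "h \<in> dec_hists C K" "\<alpha> \<in> set_pmf (indep_profile \<sigma> h)" for h \<alpha> k
  proof -
    have "\<alpha> k \<in> set_pmf (\<sigma> k h)"
      using that(2) by (auto simp: indep_profile_def set_Pi_pmf PiE_dflt_def)
    then show ?thesis
      using assms that(1) by (auto simp: strategy_profiles_def strategies_def)
  qed
  then show ?thesis
    by (auto simp: corr_profiles_def jacts_at_def)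
qed

section \<open>Nash equilibria and the system \<open>constr_N\<close>\<close>

lemma spne_iff:
  "spne C r K s \<sigma> \<longleftrightarrow> \<sigma> \<in> strategy_profiles C K \<and>
     (\<forall>i. \<forall>f\<in>strategies C K i. \<forall>h\<in>dec_hists_from C K s.
        profile_value C r K (indep_profile (\<sigma>(i := f))) h i \<le> profile_value C r K (indep_profile \<sigma>) h i)"
  by (auto simp: spne_def profile_value_def dec_hists_from_def)

text \<open>When the weights are probabilities, nonnegativity is automatic, and the value equation
  becomes the one-stage recursion for \<open>indep_profile \<sigma>\<close>.\<close>

lemma constr_N_iff:
  fixes C :: "('i::finite, 'a) ns_csg"
  assumes card: "CARD('i) = 2" and agree: "agrees_N C K s \<sigma> \<mu>"
  shows "constr_N C r K s \<mu> V \<longleftrightarrow> (\<forall>h\<in>dec_hists_from C K s. \<forall>i j. i \<noteq> j \<longrightarrow>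
     V h i = (\<Sum>\<alpha>\<in>jacts_at C (last_state h). pmf (indep_profile \<sigma> h) \<alpha> * Z C r K V i h \<alpha>) \<and>
     (\<forall>a\<in>acts_at C i (last_state h).
        (\<Sum>b\<in>acts_at C j (last_state h). pmf (\<sigma> j h) b * Z C r K V i h (joint i a b)) \<le> V h i) \<and>
     (\<Sum>a\<in>acts_at C i (last_state h). pmf (\<sigma> i h) a) = 1)"
proof -
  have \<mu>: "\<mu> i h a = pmf (\<sigma> i h) a"
    if "h \<in> dec_hists_from C K s" "a \<in> acts_at C i (last_state h)" for i h a
    using agree that by (simp add: agrees_N_def)
  show ?thesis
    unfolding constr_N_def Let_def
    by (intro ball_cong refl all_cong1 imp_cong conj_cong)
      (simp_all add: \<mu> sum_indep_profile[OF card] sum_distrib_left mult.assoc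
        flip: sum.cartesian_product)
qed

lemma sum_strategy_eq_1:
  assumes "is_ns_csg C" "f \<in> strategies C K i" "h \<in> dec_hists_from C K s"
  shows "(\<Sum>a\<in>acts_at C i (last_state h). pmf (f h) a) = 1"
  using assms
  by (intro sum_pmf_eq_1 finite_acts_at is_run_last_state)
    (auto simp: strategies_def mem_dec_hists mem_dec_hists_from)

lemma spne_imp_constr_N:
  fixes C :: "('i::finite, 'a) ns_csg"
  assumes card: "CARD('i) = 2" and C: "is_ns_csg C" and spne: "spne C r K s \<sigma>"
  shows "constr_N C r K s (\<lambda>i h. pmf (\<sigma> i h)) (profile_value C r K (indep_profile \<sigma>))"
proof -
  let ?E = "profile_value C r K (indep_profile \<sigma>)"
  have \<sigma>: "\<sigma> \<in> strategy_profiles C K"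
    using spne by (simp add: spne_def)
  have agree: "agrees_N C K s \<sigma> (\<lambda>i h. pmf (\<sigma> i h))"
    by (simp add: agrees_N_def)
  show ?thesis
    unfolding constr_N_iff[OF card agree]
  proof (intro ballI allI impI conjI)
    fix h and i j :: 'i
    assume h: "h \<in> dec_hists_from C K s" and ij: "i \<noteq> j"
    then have run: "is_run C h" "stage h < K"
      by (auto simp: mem_dec_hists_from)
    show "?E h i = (\<Sum>\<alpha>\<in>jacts_at C (last_state h). pmf (indep_profile \<sigma> h) \<alpha> * Z C r K ?E i h \<alpha>)"
      using C \<sigma> run by (intro profile_value_step indep_profile_in_corr_profiles)
    show "(\<Sum>a\<in>acts_at C i (last_state h). pmf (\<sigma> i h) a) = 1"
      using \<sigma> by (intro sum_strategy_eq_1[OF C _ h]) (auto simp: strategy_profiles_def)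
    fix a assume a: "a \<in> acts_at C i (last_state h)"
    \<comment> \<open>The deviation that tests the inequality for the pure action \<open>a\<close>:
      play \<open>a\<close> at \<open>h\<close> and follow \<open>\<sigma> i\<close>
      elsewhere.\<close>
    define f where "f = (\<sigma> i)(h := return_pmf a)"
    have f: "f \<in> strategies C K i"
      using \<sigma> a by (auto simp: f_def strategies_def strategy_profiles_def)
    have \<sigma>': "\<sigma>(i := f) \<in> strategy_profiles C K"
      using \<sigma> f by (auto simp: strategy_profiles_def)
    have "?E h i \<ge> profile_value C r K (indep_profile (\<sigma>(i := f))) h i"
      using spne f h by (simp add: spne_iff)
    also have "profile_value C r K (indep_profile (\<sigma>(i := f))) h i =
      (\<Sum>\<alpha>\<in>jacts_at C (last_state h). pmf (indep_profile (\<sigma>(i := f)) h) \<alpha> * Z C r K ?E i h \<alpha>)"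
    proof (rule profile_value_one_shot[OF C indep_profile_in_corr_profiles[OF \<sigma>'] run])
      fix h' assume "h' \<noteq> h"
      then have "(\<lambda>k. (\<sigma>(i := f)) k h') = (\<lambda>k. \<sigma> k h')"
        by (auto simp: f_def)
      then show "indep_profile (\<sigma>(i := f)) h' = indep_profile \<sigma> h'"
        by (simp add: indep_profile_def)
    qed
    \<comment> \<open>All weight of \<open>return_pmf a\<close> is on \<open>a\<close>, so the other
      terms vanish.\<close>
    also have "\<dots> = (\<Sum>a'\<in>acts_at C i (last_state h). if a' = a then
        (\<Sum>b\<in>acts_at C j (last_state h). pmf (\<sigma> j h) b * Z C r K ?E i h (joint i a b)) else 0)"
      using ij unfolding sum_indep_profile[OF card ij]
      by (intro sum.cong refl) (auto simp: f_def indicator_def)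
    also have "\<dots> = (\<Sum>b\<in>acts_at C j (last_state h). pmf (\<sigma> j h) b * Z C r K ?E i h (joint i a b))"
      using a finite_acts_at[OF C is_run_last_state[OF run(1)]] by simp
    finally show "(\<Sum>b\<in>acts_at C j (last_state h). pmf (\<sigma> j h) b * Z C r K ?E i h (joint i a b))
        \<le> ?E h i" .
  qed
qed

text \<open>The equations of the system are the one-stage recursion, whose solution is unique. The
  constraints are indexed by pairs of agents, hence the choice of a second agent.\<close>

lemma constr_N_value:
  fixes C :: "('i::finite, 'a) ns_csg"
  assumes card: "CARD('i) = 2" and "is_ns_csg C" "\<sigma> \<in> strategy_profiles C K"
    and constr: "constr_N C r K s \<mu> V" and agree: "agrees_N C K s \<sigma> \<mu>"
    and h: "h \<in> dec_hists_from C K s"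
  shows "V h i = profile_value C r K (indep_profile \<sigma>) h i"
proof -
  obtain j where "i \<noteq> j"
    using other_agent[OF card] .
  then have "value_at r K V h i = profile_value C r K (indep_profile \<sigma>) h i"
    using constr h unfolding constr_N_iff[OF card agree]
    by (intro profile_value_unique assms(2) indep_profile_in_corr_profiles assms(3))
      (auto simp: mem_dec_hists_from)
  then show ?thesis
    using h by (simp add: value_at_def mem_dec_hists_from)
qed

text \<open>When agent \<open>i\<close> deviates to \<open>f\<close>, the numbers
  \<open>V h i\<close> remain a supersolution of the recursion, so the deviation earns at most
  \<open>V h i\<close>, which is the value of \<open>\<sigma>\<close>.\<close>

lemma constr_N_imp_spne:
  fixes C :: "('i::finite, 'a) ns_csg"
  assumes card: "CARD('i) = 2" and C: "is_ns_csg C" and \<sigma>: "\<sigma> \<in> strategy_profiles C K"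
    and constr: "constr_N C r K s \<mu> V" and agree: "agrees_N C K s \<sigma> \<mu>"
  shows "spne C r K s \<sigma>"
  unfolding spne_iff
proof (intro conjI \<sigma> allI ballI)
  fix i f h
  assume f: "f \<in> strategies C K i" and h: "h \<in> dec_hists_from C K s"
  obtain j where ij: "i \<noteq> j"
    using other_agent[OF card] .
  have \<sigma>': "\<sigma>(i := f) \<in> strategy_profiles C K"
    using \<sigma> f by (auto simp: strategy_profiles_def)
  \<comment> \<open>The other agent still plays \<open>\<sigma> j\<close>, so the inequalities for
    pure actions can be averaged with the weights \<open>f h\<close>.\<close>
  have bound: "(\<Sum>\<alpha>\<in>jacts_at C (last_state h). pmf (indep_profile (\<sigma>(i := f)) h) \<alpha> * Z C r K V i h \<alpha>)
      \<le> V h i" if h: "h \<in> dec_hists_from C K s" for h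
  proof -
    have "(\<Sum>\<alpha>\<in>jacts_at C (last_state h). pmf (indep_profile (\<sigma>(i := f)) h) \<alpha> * Z C r K V i h \<alpha>) =
        (\<Sum>a\<in>acts_at C i (last_state h). pmf (f h) a *
          (\<Sum>b\<in>acts_at C j (last_state h). pmf (\<sigma> j h) b * Z C r K V i h (joint i a b)))"
      using ij by (simp add: sum_indep_profile[OF card ij])
    also have "\<dots> \<le> (\<Sum>a\<in>acts_at C i (last_state h). pmf (f h) a * V h i)"
      using constr[unfolded constr_N_iff[OF card agree], rule_format, OF h ij]
      by (intro sum_mono mult_left_mono) (blast, simp)
    also have "\<dots> = V h i"
      using sum_strategy_eq_1[OF C f h] by (simp flip: sum_distrib_right)
    finally show ?thesis .
  qed
  have "profile_value C r K (indep_profile (\<sigma>(i := f))) h i \<le> value_at r K V h i"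
    using h by (intro profile_value_le[where s = s] C indep_profile_in_corr_profiles \<sigma>' bound)
      (auto simp: mem_dec_hists_from)
  also have "\<dots> = V h i"
    using h by (simp add: value_at_def mem_dec_hists_from)
  also have "\<dots> = profile_value C r K (indep_profile \<sigma>) h i"
    by (rule constr_N_value[OF assms h])
  finally show "profile_value C r K (indep_profile (\<sigma>(i := f))) h i
      \<le> profile_value C r K (indep_profile \<sigma>) h i" .
qed

lemma ex_pmf_of_weights:
  assumes "finite A" "\<And>x. x \<in> A \<Longrightarrow> (w x :: real) \<ge> 0" "(\<Sum>x\<in>A. w x) = 1"
  obtains p where "set_pmf p \<subseteq> A" "\<And>x. x \<in> A \<Longrightarrow> pmf p x = w x"
proof -
  \<comment> \<open>\<open>embed_pmf\<close> takes weights on the whole type; continuing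
    \<open>w\<close> by 0 also gives the bound on the support.\<close>
  define w' where "w' x = (if x \<in> A then w x else 0)" for x
  have nonneg: "w' x \<ge> 0" for x
    using assms(2) by (simp add: w'_def)
  have "(\<integral>\<^sup>+x. ennreal (w' x) \<partial>count_space UNIV) = (\<Sum>x\<in>A. ennreal (w' x))"
    using assms(1) by (intro nn_integral_count_space'[of A]) (auto simp: w'_def)
  also have "\<dots> = 1"
    using assms nonneg by (simp add: sum_ennreal w'_def cong: sum.cong)
  finally have "pmf (embed_pmf w') x = w' x" for x
    by (intro pmf_embed_pmf nonneg)
  then show ?thesis
    by (intro that[of "embed_pmf w'"]) (auto simp: set_pmf_iff w'_def split: if_splits)
qed

text \<open>The program maximises over all solutions, so each must come from a profile. At a history
  from \<open>s\<close> the constraints make the weights a distribution on the available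
  actions.\<close>

lemma constr_N_ex_profile:
  fixes C :: "('i::finite, 'a) ns_csg"
  assumes card: "CARD('i) = 2" and C: "is_ns_csg C" and constr: "constr_N C r K s \<mu> V"
  obtains \<sigma> where "\<sigma> \<in> strategy_profiles C K" "agrees_N C K s \<sigma> \<mu>"
proof -
  have "\<exists>p. set_pmf p \<subseteq> acts_at C i (last_state h) \<and>
      (h \<in> dec_hists_from C K s \<longrightarrow> (\<forall>a\<in>acts_at C i (last_state h). pmf p a = \<mu> i h a))" for i h
  proof (cases "h \<in> dec_hists_from C K s")
    case True
    obtain j where "i \<noteq> j"
      using other_agent[OF card] .
    then have sum: "(\<Sum>a\<in>acts_at C i (last_state h). \<mu> i h a) = 1"
      and nonneg: "\<And>a. a \<in> acts_at C i (last_state h) \<Longrightarrow> \<mu> i h a \<ge> 0"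
      using constr True by (auto simp: constr_N_def Let_def)
    have "finite (acts_at C i (last_state h))"
      using True C by (intro finite_acts_at is_run_last_state) (auto simp: mem_dec_hists_from)
    from ex_pmf_of_weights[OF this nonneg sum] show ?thesis
      by metis
  next
    case False
    \<comment> \<open>The system does not constrain this \<open>h\<close>, but a strategy must still
      choose an available action there; the idle action ensures that one exists.\<close>
    obtain a where "a \<in> acts_at C i (last_state h)"
      using acts_at_nonempty[of C i "last_state h"] by blast
    then show ?thesis
      using False by (intro exI[of _ "return_pmf a"]) simp
  qed
  then obtain \<sigma> where "\<And>i h. set_pmf (\<sigma> i h) \<subseteq> acts_at C i (last_state h)"
      "\<And>i h a. h \<in> dec_hists_from C K s \<Longrightarrow> a \<in> acts_at C i (last_state h) \<Longrightarrow> pmf (\<sigma> i h) a = \<mu> i h a"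
    by metis
  then show ?thesis
    by (intro that[of \<sigma>]) (auto simp: strategy_profiles_def strategies_def agrees_N_def)
qed

section \<open>Correlated equilibria and the system \<open>constr_C\<close>\<close>

lemma prob_mult_rec_expect:
  fixes C :: "('i::finite, 'a) ns_csg"
  assumes card: "CARD('i) = 2" and C: "is_ns_csg C" and \<tau>: "\<tau> \<in> corr_profiles C K"
    and h: "is_run C h" "stage h < K" and ij: "i \<noteq> j"
    and a: "a \<in> acts_at C i (last_state h)" "a' \<in> acts_at C i (last_state h)"
    and pos: "measure_pmf.prob (\<tau> h) {\<alpha>. \<alpha> i = a} > 0"
  shows "measure_pmf.prob (\<tau> h) {\<alpha>. \<alpha> i = a} * rec_expect C r K \<tau> i a' a h =
    (\<Sum>b\<in>acts_at C j (last_state h). Z C r K (profile_value C r K \<tau>) i h (joint i a' b) *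
       pmf (\<tau> h) (joint i a b))"
proof -
  let ?A = "jacts_at C (last_state h)" and ?S = "{\<alpha>. \<alpha> i = a}"
  let ?Z = "Z C r K (profile_value C r K \<tau>) i h"
  \<comment> \<open>The distribution that \<open>rec_expect\<close> puts at \<open>h\<close>. It
    changes \<open>\<tau>\<close> at \<open>h\<close> only, so the continuation values are those of
    \<open>\<tau>\<close>.\<close>
  define q where "q = map_pmf (\<lambda>\<alpha>. \<alpha>(i := a')) (cond_pmf (\<tau> h) ?S)"
  have nonempty: "set_pmf (\<tau> h) \<inter> ?S \<noteq> {}"
    using pos measure_Int_set_pmf[of "\<tau> h" ?S] by (auto simp: Int_commute)
  have set_\<tau>: "set_pmf (\<tau> h) \<subseteq> ?A"
    using \<tau> h by (auto simp: corr_profiles_def mem_dec_hists)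
  then have set_q: "set_pmf q \<subseteq> ?A"
    using a(2) by (auto simp: q_def set_cond_pmf[OF nonempty] jacts_at_def)
  have fin: "finite ?A"
    using C h by (intro finite_jacts_at is_run_last_state)
  have upd: "(joint i c b)(i := a') = joint i a' b" "joint i c b i = c" for b c
    by (auto simp: joint_def)
  have "rec_expect C r K \<tau> i a' a h = profile_value C r K (\<tau>(h := q)) h i"
    by (simp add: rec_expect_def profile_value_def q_def)
  also have "\<dots> = (\<Sum>\<alpha>\<in>?A. pmf q \<alpha> * ?Z \<alpha>)"
    using \<tau> set_q by (subst profile_value_one_shot[OF C _ h, where \<tau> = \<tau>]) (auto simp: corr_profiles_def)
  also have "\<dots> = measure_pmf.expectation q ?Z"
    using fin set_q by (subst integral_measure_pmf_real[of ?A]) (auto simp: mult.commute)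
  also have "\<dots> = measure_pmf.expectation (cond_pmf (\<tau> h) ?S) (\<lambda>\<alpha>. ?Z (\<alpha>(i := a')))"
    by (simp add: q_def)
  also have "\<dots> = (\<Sum>\<alpha>\<in>?A. ?Z (\<alpha>(i := a')) * pmf (cond_pmf (\<tau> h) ?S) \<alpha>)"
    using fin set_\<tau> by (intro integral_measure_pmf_real) (auto simp: set_cond_pmf[OF nonempty])
  \<comment> \<open>Conditioning divides by the probability of the recommendation; multiplying by it
    leaves the weights \<open>pmf (\<tau> h)\<close> that appear in the constraints.\<close>
  also have "measure_pmf.prob (\<tau> h) ?S * \<dots> =
      (\<Sum>\<alpha>\<in>?A. if \<alpha> i = a then ?Z (\<alpha>(i := a')) * pmf (\<tau> h) \<alpha> else 0)"
    using pos unfolding sum_distrib_left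
    by (intro sum.cong refl) (simp add: pmf_cond[OF nonempty])
  also have "\<dots> = (\<Sum>c\<in>acts_at C i (last_state h). if c = a then
      (\<Sum>b\<in>acts_at C j (last_state h). ?Z (joint i a' b) * pmf (\<tau> h) (joint i a b)) else 0)"
    unfolding sum_jacts_at[OF card ij] by (intro sum.cong refl) (auto simp: upd)
  finally show ?thesis
    using a(1) finite_acts_at[OF C is_run_last_state[OF h(1)]] by simp
qed

text \<open>A recommendation of positive probability allows the inequality to be multiplied by that
  probability. For probability 0 the left side is vacuous, and on the right all weights
  vanish.\<close>

lemma recommendation_constr_iff:
  fixes C :: "('i::finite, 'a) ns_csg"
  assumes card: "CARD('i) = 2" and C: "is_ns_csg C" and \<tau>: "\<tau> \<in> corr_profiles C K"
    and h: "is_run C h" "stage h < K" and ij: "i \<noteq> j"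
    and a: "a \<in> acts_at C i (last_state h)" "a' \<in> acts_at C i (last_state h)"
  shows "(measure_pmf.prob (\<tau> h) {\<alpha>. \<alpha> i = a} > 0 \<longrightarrow>
      rec_expect C r K \<tau> i a' a h \<le> rec_expect C r K \<tau> i a a h) \<longleftrightarrow>
    (\<Sum>b\<in>acts_at C j (last_state h).
       (Z C r K (profile_value C r K \<tau>) i h (joint i a b) -
        Z C r K (profile_value C r K \<tau>) i h (joint i a' b)) * pmf (\<tau> h) (joint i a b)) \<ge> 0"
proof (cases "measure_pmf.prob (\<tau> h) {\<alpha>. \<alpha> i = a} > 0")
  case True
  note rec = prob_mult_rec_expect[OF card C \<tau> h ij a(1) _ True, symmetric]
  show ?thesis
    using True by (simp add: left_diff_distrib sum_subtractf rec a)
next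
  case False
  have "pmf (\<tau> h) (joint i a b) \<le> measure_pmf.prob (\<tau> h) {\<alpha>. \<alpha> i = a}" for b
    by (auto simp: measure_pmf_single[symmetric] joint_def intro!: measure_pmf.finite_measure_mono)
  then have "pmf (\<tau> h) (joint i a b) = 0" for b
    using False by (meson antisym leI order_trans pmf_nonneg)
  then show ?thesis
    using False by simp
qed

lemma constr_C_iff:
  fixes C :: "('i::finite, 'a) ns_csg"
  assumes card: "CARD('i) = 2" and agree: "agrees_C C K s \<tau> \<mu>"
  shows "constr_C C r K s \<mu> V \<longleftrightarrow> (\<forall>h\<in>dec_hists_from C K s. \<forall>i j. i \<noteq> j \<longrightarrow>
     V h i = (\<Sum>\<alpha>\<in>jacts_at C (last_state h). pmf (\<tau> h) \<alpha> * Z C r K V i h \<alpha>) \<and>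
     (\<forall>a\<in>acts_at C i (last_state h). \<forall>a'\<in>acts_at C i (last_state h).
        (\<Sum>b\<in>acts_at C j (last_state h).
           (Z C r K V i h (joint i a b) - Z C r K V i h (joint i a' b)) *
             pmf (\<tau> h) (joint i a b)) \<ge> 0) \<and>
     (\<Sum>\<alpha>\<in>jacts_at C (last_state h). pmf (\<tau> h) \<alpha>) = 1)"
proof -
  have \<mu>: "\<mu> h \<alpha> = pmf (\<tau> h) \<alpha>"
    if "h \<in> dec_hists_from C K s" "\<alpha> \<in> jacts_at C (last_state h)" for h \<alpha>
    using agree that by (simp add: agrees_C_def)
  show ?thesis
    unfolding constr_C_def Let_def
    by (intro ball_cong refl all_cong1 imp_cong conj_cong)
      (simp_all add: \<mu> joint_mem_jacts_at[OF card])
qed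

text \<open>The form with \<open>value_at\<close> includes stage \<open>K\<close>, as comparing
  \<open>Z\<close> for \<open>V\<close> with \<open>Z\<close> for the value involves successors that
  may be final.\<close>

lemma constr_C_value:
  fixes C :: "('i::finite, 'a) ns_csg"
  assumes card: "CARD('i) = 2" and "is_ns_csg C" "\<tau> \<in> corr_profiles C K"
    and constr: "constr_C C r K s \<mu> V" and agree: "agrees_C C K s \<tau> \<mu>"
    and h: "is_run C h" "stage h \<le> K" "fst h = s"
  shows "value_at r K V h i = profile_value C r K \<tau> h i"
proof -
  obtain j where "i \<noteq> j"
    using other_agent[OF card] .
  then have "V h i = (\<Sum>\<alpha>\<in>jacts_at C (last_state h). pmf (\<tau> h) \<alpha> * Z C r K V i h \<alpha>)"
    if "h \<in> dec_hists_from C K s" for h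
    using that constr unfolding constr_C_iff[OF card agree] by blast
  from profile_value_unique[where V = V and i = i, OF assms(2,3) this h] show ?thesis .
qed

text \<open>With its own value as \<open>V\<close>, every correlated profile satisfies the value
  equations and the normalisation, so only the incentive constraints are at stake.\<close>

lemma spce_iff_constr_C:
  fixes C :: "('i::finite, 'a) ns_csg"
  assumes card: "CARD('i) = 2" and C: "is_ns_csg C" and \<tau>: "\<tau> \<in> corr_profiles C K"
  shows "spce C r K s \<tau> \<longleftrightarrow> constr_C C r K s (\<lambda>h. pmf (\<tau> h)) (profile_value C r K \<tau>)"
    (is "_ \<longleftrightarrow> constr_C C r K s ?\<mu> ?E")
proof -
  have agree: "agrees_C C K s \<tau> ?\<mu>"
    by (simp add: agrees_C_def)
  let ?inc = "\<lambda>h i j a a'. (\<Sum>b\<in>acts_at C j (last_state h).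
    (Z C r K ?E i h (joint i a b) - Z C r K ?E i h (joint i a' b)) * pmf (\<tau> h) (joint i a b)) \<ge> 0"
  have "spce C r K s \<tau> \<longleftrightarrow> (\<forall>h\<in>dec_hists_from C K s. \<forall>i.
      \<forall>a\<in>acts_at C i (last_state h). \<forall>a'\<in>acts_at C i (last_state h).
        measure_pmf.prob (\<tau> h) {\<alpha>. \<alpha> i = a} > 0 \<longrightarrow>
          rec_expect C r K \<tau> i a a h \<ge> rec_expect C r K \<tau> i a' a h)"
    using \<tau> unfolding spce_def dec_hists_from_def by blast
  also have "\<dots> \<longleftrightarrow> (\<forall>h\<in>dec_hists_from C K s. \<forall>i j. i \<noteq> j \<longrightarrow>
      (\<forall>a\<in>acts_at C i (last_state h). \<forall>a'\<in>acts_at C i (last_state h). ?inc h i j a a'))"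
  proof (intro ball_cong refl all_cong1)
    fix h and i :: 'i
    assume "h \<in> dec_hists_from C K s"
    then have h: "is_run C h" "stage h < K"
      by (auto simp: mem_dec_hists_from)
    obtain j where ij: "i \<noteq> j"
      using other_agent[OF card] .
    \<comment> \<open>There is only one agent other than \<open>i\<close>, so the quantifier
      collapses.\<close>
    have all: "(\<forall>j'. i \<noteq> j' \<longrightarrow> R j') \<longleftrightarrow> R j" for R
      using ij by (simp add: all_agents_iff[OF card ij])
    show "(\<forall>a\<in>acts_at C i (last_state h). \<forall>a'\<in>acts_at C i (last_state h).
        measure_pmf.prob (\<tau> h) {\<alpha>. \<alpha> i = a} > 0 \<longrightarrow>
          rec_expect C r K \<tau> i a a h \<ge> rec_expect C r K \<tau> i a' a h) \<longleftrightarrow>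
      (\<forall>j. i \<noteq> j \<longrightarrow>
        (\<forall>a\<in>acts_at C i (last_state h). \<forall>a'\<in>acts_at C i (last_state h). ?inc h i j a a'))"
      unfolding all by (intro ball_cong refl recommendation_constr_iff[OF card C \<tau> h ij])
  qed
  also have "\<dots> \<longleftrightarrow> constr_C C r K s ?\<mu> ?E"
    unfolding constr_C_iff[OF card agree]
  proof (intro ball_cong refl all_cong1 imp_cong)
    fix h and i j :: 'i
    assume "h \<in> dec_hists_from C K s"
    then have h: "is_run C h" "stage h < K"
      by (auto simp: mem_dec_hists_from)
    have "(\<Sum>\<alpha>\<in>jacts_at C (last_state h). pmf (\<tau> h) \<alpha>) = 1"
      using \<tau> h C by (intro sum_pmf_eq_1 finite_jacts_at is_run_last_state)
        (auto simp: corr_profiles_def mem_dec_hists)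
    with profile_value_step[OF C \<tau> h, of r i]
    show "(\<forall>a\<in>acts_at C i (last_state h). \<forall>a'\<in>acts_at C i (last_state h). ?inc h i j a a') \<longleftrightarrow>
      ?E h i = (\<Sum>\<alpha>\<in>jacts_at C (last_state h). pmf (\<tau> h) \<alpha> * Z C r K ?E i h \<alpha>) \<and>
      (\<forall>a\<in>acts_at C i (last_state h). \<forall>a'\<in>acts_at C i (last_state h). ?inc h i j a a') \<and>
      (\<Sum>\<alpha>\<in>jacts_at C (last_state h). pmf (\<tau> h) \<alpha>) = 1"
      by blast
  qed
  finally show ?thesis .
qed

text \<open>A solution \<open>V\<close> is arbitrary at histories outside the system, but wherever
  it enters the constraints it equals the value. Hence the value is a solution too, and
  \<open>spce_iff_constr_C\<close> applies.\<close>

lemma constr_C_imp_spce: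
  fixes C :: "('i::finite, 'a) ns_csg"
  assumes card: "CARD('i) = 2" and C: "is_ns_csg C" and \<tau>: "\<tau> \<in> corr_profiles C K"
    and constr: "constr_C C r K s \<mu> V" and agree: "agrees_C C K s \<tau> \<mu>"
  shows "spce C r K s \<tau>"
proof -
  let ?E = "profile_value C r K \<tau>"
  have Z_eq: "Z C r K V i h \<alpha> = Z C r K ?E i h \<alpha>"
    if "h \<in> dec_hists_from C K s" "\<alpha> \<in> jacts_at C (last_state h)" for i h \<alpha>
    using that constr_C_value[OF assms]
    by (intro Z_cong) (auto simp: mem_dec_hists_from is_run_ext_hist value_at_profile_value)
  have V_eq: "V h i = ?E h i" if "h \<in> dec_hists_from C K s" for i h
    using that constr_C_value[OF assms, of h i] by (auto simp: mem_dec_hists_from value_at_def)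
  have agree': "agrees_C C K s \<tau> (\<lambda>h. pmf (\<tau> h))"
    by (simp add: agrees_C_def)
  have "constr_C C r K s (\<lambda>h. pmf (\<tau> h)) ?E"
    using constr unfolding constr_C_iff[OF card agree] constr_C_iff[OF card agree']
    by (simp add: V_eq Z_eq joint_mem_jacts_at[OF card])
  then show ?thesis
    using spce_iff_constr_C[OF card C \<tau>] by blast
qed

lemma constr_C_ex_profile:
  fixes C :: "('i::finite, 'a) ns_csg"
  assumes card: "CARD('i) = 2" and C: "is_ns_csg C" and constr: "constr_C C r K s \<mu> V"
  obtains \<tau> where "\<tau> \<in> corr_profiles C K" "agrees_C C K s \<tau> \<mu>"
proof -
  have "\<exists>p. set_pmf p \<subseteq> jacts_at C (last_state h) \<and>
      (h \<in> dec_hists_from C K s \<longrightarrow> (\<forall>\<alpha>\<in>jacts_at C (last_state h). pmf p \<alpha> = \<mu> h \<alpha>))" for h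
  proof (cases "h \<in> dec_hists_from C K s")
    case True
    obtain i j :: 'i where "i \<noteq> j"
      using other_agent[OF card] by metis
    then have sum: "(\<Sum>\<alpha>\<in>jacts_at C (last_state h). \<mu> h \<alpha>) = 1"
      and nonneg: "\<And>\<alpha>. \<alpha> \<in> jacts_at C (last_state h) \<Longrightarrow> \<mu> h \<alpha> \<ge> 0"
      using constr True by (auto simp: constr_C_def Let_def)
    have "finite (jacts_at C (last_state h))"
      using True C by (intro finite_jacts_at is_run_last_state) (auto simp: mem_dec_hists_from)
    from ex_pmf_of_weights[OF this nonneg sum] show ?thesis
      by metis
  next
    case False
    \<comment> \<open>An arbitrary available joint action, for histories that the system does not
      constrain.\<close>
    have "(\<lambda>i. SOME a. a \<in> acts_at C i (last_state h)) \<in> jacts_at C (last_state h)"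
      by (simp add: jacts_at_def some_in_eq acts_at_nonempty)
    then show ?thesis
      using False by (intro exI[of _ "return_pmf (\<lambda>i. SOME a. a \<in> acts_at C i (last_state h))"]) simp
  qed
  then obtain \<tau> where "\<And>h. set_pmf (\<tau> h) \<subseteq> jacts_at C (last_state h)"
      "\<And>h \<alpha>. h \<in> dec_hists_from C K s \<Longrightarrow> \<alpha> \<in> jacts_at C (last_state h) \<Longrightarrow> pmf (\<tau> h) \<alpha> = \<mu> h \<alpha>"
    by metis
  then show ?thesis
    by (intro that[of \<tau>]) (auto simp: corr_profiles_def agrees_C_def)
qed

section \<open>Welfare maximisation and the four characterisations\<close>

lemma init_hist_in_dec_hists_from:
  "K \<ge> 1 \<Longrightarrow> s \<in> gstates C \<Longrightarrow> init_hist s \<in> dec_hists_from C K s"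
  by (simp add: init_hist_def mem_dec_hists_from)

text \<open>The common core of both welfare claims: \<open>P\<close> holds the profiles,
  \<open>eq\<close> the equilibria and \<open>sol\<close> the feasible pairs. Equilibria and
  solutions correspond with equal welfare and objective, so their maxima correspond.\<close>

lemma welfare_optimal_iff:
  fixes W :: "'p \<Rightarrow> real" and obj :: "'v \<Rightarrow> real"
  assumes eq_imp: "\<And>p. eq p \<Longrightarrow> p \<in> P"
    and eq_iff: "\<And>p. p \<in> P \<Longrightarrow> eq p \<longleftrightarrow> (\<exists>m v. sol m v \<and> agree p m)"
    and obj: "\<And>p m v. p \<in> P \<Longrightarrow> sol m v \<Longrightarrow> agree p m \<Longrightarrow> W p = obj v"
    and ex: "\<And>m v. sol m v \<Longrightarrow> \<exists>p\<in>P. agree p m"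
    and "p \<in> P"
  shows "(eq p \<and> (\<forall>p'. eq p' \<longrightarrow> W p' \<le> W p)) \<longleftrightarrow>
    (\<exists>m v. (sol m v \<and> (\<forall>m' v'. sol m' v' \<longrightarrow> obj v' \<le> obj v)) \<and> agree p m \<and> W p = obj v)"
proof
  assume opt: "eq p \<and> (\<forall>p'. eq p' \<longrightarrow> W p' \<le> W p)"
  then obtain m v where sol: "sol m v" "agree p m"
    using eq_iff \<open>p \<in> P\<close> by blast
  \<comment> \<open>A competing solution is realised by a profile, which is then an equilibrium, so
    its objective is a welfare that \<open>p\<close> already dominates.\<close>
  have "obj v' \<le> obj v" if sol': "sol m' v'" for m' v'
  proof -
    obtain p' where p': "p' \<in> P" "agree p' m'"
      using ex[OF sol'] by blast
    then have "W p' \<le> W p"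
      using opt eq_iff sol' by blast
    then show ?thesis
      using obj[OF p'(1) sol' p'(2)] obj[OF \<open>p \<in> P\<close> sol] by simp
  qed
  then show "\<exists>m v. (sol m v \<and> (\<forall>m' v'. sol m' v' \<longrightarrow> obj v' \<le> obj v)) \<and> agree p m \<and> W p = obj v"
    using sol obj[OF \<open>p \<in> P\<close> sol] by blast
next
  assume "\<exists>m v. (sol m v \<and> (\<forall>m' v'. sol m' v' \<longrightarrow> obj v' \<le> obj v)) \<and> agree p m \<and> W p = obj v"
  then obtain m v where sol: "sol m v" "agree p m" "W p = obj v"
    and max: "\<And>m' v'. sol m' v' \<Longrightarrow> obj v' \<le> obj v"
    by blast
  have "W p' \<le> W p" if eq': "eq p'" for p'
  proof -
    have p': "p' \<in> P"
      using eq' by (rule eq_imp)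
    then obtain m' v' where sol': "sol m' v'" "agree p' m'"
      using eq' eq_iff by blast
    then show ?thesis
      using obj[OF p' sol'] max[OF sol'(1)] sol(3) by simp
  qed
  then show "eq p \<and> (\<forall>p'. eq p' \<longrightarrow> W p' \<le> W p)"
    using sol eq_iff \<open>p \<in> P\<close> by blast
qed

text \<open>The clause on the social welfare is asserted twice: as a property of the optimal
  solution that exists, and for every optimal solution agreeing with the profile.\<close>

theorem theorem9:
  fixes C :: "('i::finite, 'a) ns_csg"
    and r :: "('i, 'a) rewards"
    and K :: nat
    and s :: "'i gstate"
  assumes "CARD('i) = 2"
    and "is_ns_csg C"
    and "K \<ge> 1"
    and "s \<in> gstates C"
  shows
    "(\<forall>\<sigma> \<in> strategy_profiles C K.
        spne C r K s \<sigma> \<longleftrightarrow> (\<exists>\<mu> V. constr_N C r K s \<mu> V \<and> agrees_N C K s \<sigma> \<mu>)) \<and>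
     (\<forall>\<tau> \<in> corr_profiles C K.
        spce C r K s \<tau> \<longleftrightarrow> (\<exists>\<mu> V. constr_C C r K s \<mu> V \<and> agrees_C C K s \<tau> \<mu>)) \<and>
     (\<forall>\<sigma> \<in> strategy_profiles C K.
        (sw_spne C r K s \<sigma> \<longleftrightarrow>
           (\<exists>\<mu> V. optimal_N C r K s \<mu> V \<and> agrees_N C K s \<sigma> \<mu> \<and>
              welfare C r K (indep_profile \<sigma>) (init_hist s) = objective s V)) \<and>
        (\<forall>\<mu> V. optimal_N C r K s \<mu> V \<and> agrees_N C K s \<sigma> \<mu> \<longrightarrow>
           welfare C r K (indep_profile \<sigma>) (init_hist s) = objective s V)) \<and>
     (\<forall>\<tau> \<in> corr_profiles C K.
        (sw_spce C r K s \<tau> \<longleftrightarrow>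
           (\<exists>\<mu> V. optimal_C C r K s \<mu> V \<and> agrees_C C K s \<tau> \<mu> \<and>
              welfare C r K \<tau> (init_hist s) = objective s V)) \<and>
        (\<forall>\<mu> V. optimal_C C r K s \<mu> V \<and> agrees_C C K s \<tau> \<mu> \<longrightarrow>
           welfare C r K \<tau> (init_hist s) = objective s V))"
proof -
  note card = assms(1) and C = assms(2)
  \<comment> \<open>As \<open>K \<ge> 1\<close>, the initial history is a decision history, so the
    objective is built from constrained variables and not from final rewards.\<close>
  have init: "init_hist s \<in> dec_hists_from C K s"
    using assms(3,4) by (rule init_hist_in_dec_hists_from)
  have spne_iff_sol: "spne C r K s \<sigma> \<longleftrightarrow> (\<exists>\<mu> V. constr_N C r K s \<mu> V \<and> agrees_N C K s \<sigma> \<mu>)"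
    if "\<sigma> \<in> strategy_profiles C K" for \<sigma>
  proof
    assume "spne C r K s \<sigma>"
    then have "constr_N C r K s (\<lambda>i h. pmf (\<sigma> i h)) (profile_value C r K (indep_profile \<sigma>))"
      by (rule spne_imp_constr_N[OF card C])
    moreover have "agrees_N C K s \<sigma> (\<lambda>i h. pmf (\<sigma> i h))"
      by (simp add: agrees_N_def)
    ultimately show "\<exists>\<mu> V. constr_N C r K s \<mu> V \<and> agrees_N C K s \<sigma> \<mu>"
      by blast
  qed (use constr_N_imp_spne[OF card C that] in blast)
  have spce_iff_sol: "spce C r K s \<tau> \<longleftrightarrow> (\<exists>\<mu> V. constr_C C r K s \<mu> V \<and> agrees_C C K s \<tau> \<mu>)"
    if "\<tau> \<in> corr_profiles C K" for \<tau>
  proof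
    assume "spce C r K s \<tau>"
    then have "constr_C C r K s (\<lambda>h. pmf (\<tau> h)) (profile_value C r K \<tau>)"
      by (simp add: spce_iff_constr_C[OF card C that])
    moreover have "agrees_C C K s \<tau> (\<lambda>h. pmf (\<tau> h))"
      by (simp add: agrees_C_def)
    ultimately show "\<exists>\<mu> V. constr_C C r K s \<mu> V \<and> agrees_C C K s \<tau> \<mu>"
      by blast
  qed (use constr_C_imp_spce[OF card C that] in blast)
  have welfare_N: "welfare C r K (indep_profile \<sigma>) (init_hist s) = objective s V"
    if "\<sigma> \<in> strategy_profiles C K" "constr_N C r K s \<mu> V" "agrees_N C K s \<sigma> \<mu>" for \<sigma> \<mu> V
    using constr_N_value[OF card C that init] by (simp add: welfare_eq_sum_value objective_def)
  have welfare_C: "welfare C r K \<tau> (init_hist s) = objective s V"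
    if "\<tau> \<in> corr_profiles C K" "constr_C C r K s \<mu> V" "agrees_C C K s \<tau> \<mu>" for \<tau> \<mu> V
    using constr_C_value[OF card C that, of "init_hist s"] init
    by (simp add: welfare_eq_sum_value objective_def value_at_def mem_dec_hists_from)
  have sw_N: "sw_spne C r K s \<sigma> \<longleftrightarrow> (\<exists>\<mu> V. optimal_N C r K s \<mu> V \<and> agrees_N C K s \<sigma> \<mu> \<and>
      welfare C r K (indep_profile \<sigma>) (init_hist s) = objective s V)"
    if "\<sigma> \<in> strategy_profiles C K" for \<sigma>
    unfolding sw_spne_def optimal_N_def
  proof (rule welfare_optimal_iff[where P = "strategy_profiles C K"
        and W = "\<lambda>\<sigma>. welfare C r K (indep_profile \<sigma>) (init_hist s)"])
    show "\<sigma>' \<in> strategy_profiles C K" if "spne C r K s \<sigma>'" for \<sigma>'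
      using that by (simp add: spne_def)
    show "\<exists>\<sigma>'\<in>strategy_profiles C K. agrees_N C K s \<sigma>' \<mu>" if "constr_N C r K s \<mu> V" for \<mu> V
      using constr_N_ex_profile[OF card C that] by blast
  qed (fact spne_iff_sol welfare_N that)+
  have sw_C: "sw_spce C r K s \<tau> \<longleftrightarrow> (\<exists>\<mu> V. optimal_C C r K s \<mu> V \<and> agrees_C C K s \<tau> \<mu> \<and>
      welfare C r K \<tau> (init_hist s) = objective s V)"
    if "\<tau> \<in> corr_profiles C K" for \<tau>
    unfolding sw_spce_def optimal_C_def
  proof (rule welfare_optimal_iff[where P = "corr_profiles C K"
        and W = "\<lambda>\<tau>. welfare C r K \<tau> (init_hist s)"])
    show "\<tau>' \<in> corr_profiles C K" if "spce C r K s \<tau>'" for \<tau>'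
      using that by (simp add: spce_def)
    show "\<exists>\<tau>'\<in>corr_profiles C K. agrees_C C K s \<tau>' \<mu>" if "constr_C C r K s \<mu> V" for \<mu> V
      using constr_C_ex_profile[OF card C that] by blast
  qed (fact spce_iff_sol welfare_C that)+
  show ?thesis
    using spne_iff_sol spce_iff_sol sw_N sw_C welfare_N welfare_C
    unfolding optimal_N_def optimal_C_def by blast
qed

end
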